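(* Let $\mathbb I=(\mathcal M_1,\dots,\mathcal M_n,\mathcal F,h)$ be an instance of CICS, and let $W^*_{\mathcal M_1},\dots,W^*_{\mathcal M_n}$ be mutually independent, where $W^*_{\mathcal M_i}$ is the water filling surrogate cost of $\mathcal M_i$ in the minimization setting and the water draining surrogate value in the maximization setting. Then: (1) in the minimization setting, $\mathrm{OPT}(\mathbb I)\ge\mathbb E\big[\min_{S\in\mathcal F}\big(\sum_{i\in S}W^*_{\mathcal M_i}+h(S)\big)\big]$; (2) in the maximization setting, $\mathrm{OPT}(\mathbb I)\le\mathbb E\big[\max_{S\in\mathcal F}\big(\sum_{i\in S}W^*_{\mathcal M_i}+h(S)\big)\big]$.
   Context: A costly information MDP is $\mathcal M=(S,\sigma,A,c,\mathcal D,V,T)$: a finite state set, start state $\sigma$, terminal states $T$, for each nonterminal $s$ a finite nonempty action set $A(s)$ with costs $c(a)\ge0$ and transition distributions $\mathcal D(s,a,\cdot)$; $v(s)$ is the conditional expected value at $s$ of an underlying nonnegative random variable. At a terminal state the only action is "accept" (cost $0$, yields value $v(t)$, ends the process). Acyclic, bounded horizon. CICS: an instance consists of independent MDPs $\mathcal M_1,\dots,\mathcal M_n$, an arbitrary family $\mathcal F\subseteq2^{[n]}$ and a function $h:\mathcal F\to\mathbb R$. At each step a policy chooses an MDP and advances it through one of its actions (paying the action cost); the game ends once the policy has accepted a feasible set $S\in\mathcal F$ of MDPs (policies are required to end with an accepted set in $\mathcal F$). If $A$ is the set of actions taken, $S$ the set of accepted MDPs and $T'$ the accepted terminals, the cost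 (minimization) is $\sum_{t\in T'}v(t)+h(S)+\sum_{a\in A}c(a)$ and the utility (maximization) is $\sum_{t\in T'}v(t)+h(S)-\sum_{a\in A}c(a)$; $\mathrm{OPT}(\mathbb I)$ is the minimum expected cost, resp. maximum expected utility. For $y\in\mathbb R$, in the local game $(\mathcal M,y)$ a policy advances $\mathcal M$ and finally accepts either an outside option of deterministic value $y$ or a terminal state of $\mathcal M$; in minimization $f_{\mathcal M}(y)$ is its minimum expected total cost (costs plus accepted value) and the water filling surrogate cost $W^*_{\mathcal M}$ satisfies $\mathbb E[\min(y,W^*_{\mathcal M})]=f_{\mathcal M}(y)$ for all $y$; in maximization $f_{\mathcal M}(y)$ is its maximum expected utility (accepted value minus costs) and the water draining surrogate value $W^*_{\mathcal M}$ satisfies $\mathbb E[\max(y,W^*_{\mathcal M})]=f_{\mathcal M}(y)$ for all $y$. *)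

theory Defs
  imports "HOL-Probability.Probability"
begin

section \<open>Costly information MDPs\<close>

text \<open>The field \<open>val\<close> is $v$, the conditional expected value at a state. The accept action
  available at terminal states is not an element of \<open>actions\<close>; it is a separate move of the
  policies below.\<close>

record ('s, 'a) mdp =
  states :: "'s set"
  start :: 's
  terminals :: "'s set"
  actions :: "'s \<Rightarrow> 'a set"
  cost :: "'a \<Rightarrow> real"
  trans :: "'s \<Rightarrow> 'a \<Rightarrow> 's pmf"
  val :: "'s \<Rightarrow> real"

definition succ_rel :: "('s, 'a) mdp \<Rightarrow> ('s \<times> 's) set" where
  "succ_rel M = {(s, s'). s \<in> states M - terminals M \<and>
     (\<exists>a \<in> actions M s. s' \<in> set_pmf (trans M s a))}"

text \<open>That \<open>val\<close> consists of conditional expectations of one underlying nonnegative random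
  variable is the nonnegativity of \<open>val\<close> together with the tower law for each action.
  With finitely many states, acyclicity bounds the horizon.\<close>

definition costly_information_mdp :: "('s, 'a) mdp \<Rightarrow> bool" where
  "costly_information_mdp M \<longleftrightarrow>
     finite (states M) \<and> start M \<in> states M \<and> terminals M \<subseteq> states M \<and>
     (\<forall>s \<in> states M. 0 \<le> val M s) \<and>
     (\<forall>s \<in> states M - terminals M.
        finite (actions M s) \<and> actions M s \<noteq> {} \<and>
        (\<forall>a \<in> actions M s.
           0 \<le> cost M a \<and>
           set_pmf (trans M s a) \<subseteq> states M \<and>
           val M s = measure_pmf.expectation (trans M s a) (val M))) \<and>
     acyclic (succ_rel M)"


section \<open>The local game and surrogates\<close>

text \<open>A policy is a decision tree: after an action the continuation depends on the state
  reached, and hence on the whole history. \<open>L_Random\<close> lets a policy randomize; since only finitely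
  many moves are ever available, mixtures with finite support are enough.\<close>

datatype ('s, 'a) local_policy =
    L_Outside
  | L_Accept
  | L_Advance 'a "'s \<Rightarrow> ('s, 'a) local_policy"
  | L_Random "('s, 'a) local_policy pmf"

inductive local_valid :: "('s, 'a) mdp \<Rightarrow> 's \<Rightarrow> ('s, 'a) local_policy \<Rightarrow> bool"
  for M where
  outside: "local_valid M s L_Outside"
| accept: "s \<in> terminals M \<Longrightarrow> local_valid M s L_Accept"
| advance: "\<lbrakk>s \<in> states M - terminals M; a \<in> actions M s;
             \<And>s'. s' \<in> set_pmf (trans M s a) \<Longrightarrow> local_valid M s' (k s')\<rbrakk>
            \<Longrightarrow> local_valid M s (L_Advance a k)"
| random: "\<lbrakk>finite (set_pmf p); \<And>\<pi>. \<pi> \<in> set_pmf p \<Longrightarrow> local_valid M s \<pi>\<rbrakk>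
           \<Longrightarrow> local_valid M s (L_Random p)"

text \<open>The joint distribution of the accepted value and the total action cost paid, for outside
  option \<open>y\<close>.\<close>

primrec local_play :: "('s, 'a) mdp \<Rightarrow> real \<Rightarrow> ('s, 'a) local_policy \<Rightarrow> 's \<Rightarrow> (real \<times> real) pmf"
  where
  "local_play M y L_Outside = (\<lambda>s. return_pmf (y, 0))"
| "local_play M y L_Accept = (\<lambda>s. return_pmf (val M s, 0))"
| "local_play M y (L_Advance a k) = (\<lambda>s. bind_pmf (trans M s a)
     (\<lambda>s'. map_pmf (\<lambda>(x, c). (x, cost M a + c)) (local_play M y (k s') s')))"
| "local_play M y (L_Random p) = (\<lambda>s. bind_pmf (map_pmf (local_play M y) p) (\<lambda>q. q s))"

definition local_min :: "('s, 'a) mdp \<Rightarrow> real \<Rightarrow> real" where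
  "local_min M y = Inf {measure_pmf.expectation (local_play M y \<pi> (start M)) (\<lambda>(x, c). x + c) | \<pi>.
     local_valid M (start M) \<pi>}"

definition local_max :: "('s, 'a) mdp \<Rightarrow> real \<Rightarrow> real" where
  "local_max M y = Sup {measure_pmf.expectation (local_play M y \<pi> (start M)) (\<lambda>(x, c). x - c) | \<pi>.
     local_valid M (start M) \<pi>}"

text \<open>\<open>has_bochner_integral\<close> demands integrability besides the value of the expectation.\<close>

definition water_filling_surrogate :: "'w measure \<Rightarrow> ('w \<Rightarrow> real) \<Rightarrow> ('s, 'a) mdp \<Rightarrow> bool" where
  "water_filling_surrogate P W M \<longleftrightarrow>
     (\<forall>y. has_bochner_integral P (\<lambda>\<omega>. min y (W \<omega>)) (local_min M y))"

definition water_draining_surrogate :: "'w measure \<Rightarrow> ('w \<Rightarrow> real) \<Rightarrow> ('s, 'a) mdp \<Rightarrow> bool" where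
  "water_draining_surrogate P W M \<longleftrightarrow>
     (\<forall>y. has_bochner_integral P (\<lambda>\<omega>. max y (W \<omega>)) (local_max M y))"


section \<open>Costly information combinatorial selection\<close>

record ('s, 'a) cics =
  num :: nat
  mdps :: "nat \<Rightarrow> ('s, 'a) mdp"
  feasible :: "nat set set"
  bonus :: "nat set \<Rightarrow> real"

definition cics_instance :: "('s, 'a) cics \<Rightarrow> bool" where
  "cics_instance I \<longleftrightarrow>
     (\<forall>i \<in> {1..num I}. costly_information_mdp (mdps I i)) \<and>
     feasible I \<subseteq> Pow {1..num I} \<and> feasible I \<noteq> {}"

datatype ('s, 'a) policy =
    Stop
  | Accept nat "('s, 'a) policy"
  | Advance nat 'a "'s \<Rightarrow> ('s, 'a) policy"
  | Random "('s, 'a) policy pmf"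

text \<open>A position consists of the current states of all MDPs and the set of MDPs accepted so far.
  A policy may stop whenever the accepted set is feasible, but is not forced to: it may
  go on towards another feasible set.\<close>

inductive valid :: "('s, 'a) cics \<Rightarrow> (nat \<Rightarrow> 's) \<Rightarrow> nat set \<Rightarrow> ('s, 'a) policy \<Rightarrow> bool"
  for I where
  stop: "S \<in> feasible I \<Longrightarrow> valid I x S Stop"
| accept: "\<lbrakk>i \<in> {1..num I} - S; x i \<in> terminals (mdps I i); valid I x (insert i S) \<pi>\<rbrakk>
           \<Longrightarrow> valid I x S (Accept i \<pi>)"
| advance: "\<lbrakk>i \<in> {1..num I}; x i \<in> states (mdps I i) - terminals (mdps I i);
             a \<in> actions (mdps I i) (x i);
             \<And>s'. s' \<in> set_pmf (trans (mdps I i) (x i) a) \<Longrightarrow> valid I (x(i := s')) S (k s')\<rbrakk>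
            \<Longrightarrow> valid I x S (Advance i a k)"
| random: "\<lbrakk>finite (set_pmf p); \<And>\<pi>. \<pi> \<in> set_pmf p \<Longrightarrow> valid I x S \<pi>\<rbrakk>
           \<Longrightarrow> valid I x S (Random p)"

text \<open>The joint distribution of the total value of the accepted terminals, the final accepted set,
  and the total action cost paid.\<close>

primrec play ::
  "('s, 'a) cics \<Rightarrow> ('s, 'a) policy \<Rightarrow> (nat \<Rightarrow> 's) \<Rightarrow> nat set \<Rightarrow> (real \<times> nat set \<times> real) pmf"
  where
  "play I Stop = (\<lambda>x S. return_pmf (0, S, 0))"
| "play I (Accept i \<pi>) = (\<lambda>x S.
     map_pmf (\<lambda>(w, R, c). (val (mdps I i) (x i) + w, R, c)) (play I \<pi> x (insert i S)))"
| "play I (Advance i a k) = (\<lambda>x S. bind_pmf (trans (mdps I i) (x i) a)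
     (\<lambda>s'. map_pmf (\<lambda>(w, R, c). (w, R, cost (mdps I i) a + c)) (play I (k s') (x(i := s')) S)))"
| "play I (Random p) = (\<lambda>x S. bind_pmf (map_pmf (play I) p) (\<lambda>q. q x S))"

definition start_pos :: "('s, 'a) cics \<Rightarrow> nat \<Rightarrow> 's" where
  "start_pos I = (\<lambda>i. start (mdps I i))"

definition OPT_min :: "('s, 'a) cics \<Rightarrow> real" where
  "OPT_min I = Inf {measure_pmf.expectation (play I \<pi> (start_pos I) {})
      (\<lambda>(w, S, c). w + bonus I S + c) | \<pi>. valid I (start_pos I) {} \<pi>}"

definition OPT_max :: "('s, 'a) cics \<Rightarrow> real" where
  "OPT_max I = Sup {measure_pmf.expectation (play I \<pi> (start_pos I) {})
      (\<lambda>(w, S, c). w + bonus I S - c) | \<pi>. valid I (start_pos I) {} \<pi>}"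

end

theory Submission
  imports Defs
begin

text \<open>Maximization becomes minimization once \<open>val\<close>, the bonus and the surrogates change sign, so
  everything is done for minimization with a sign \<open>\<sigma>\<close>. The surrogate at a state is realized
  as a finitely supported law: the local value as a function of the outside option is a minimum of
  finitely many lines, of slope 1 near minus infinity and constant near plus infinity, hence of the
  form \<open>E (min y w)\<close>. The value of a position is the expectation of the best completion under the
  product of these laws. In one coordinate the completion value is, up to constants,
  \<open>min y w\<close> for some threshold \<open>y\<close> fixed by the other coordinates, so the Bellman inequality of the
  local game shows that an action lowers the expected position value by at most its cost. Induction
  over the policy bounds its expected cost from below by the initial position value.\<close>


section \<open>Minima of finitely many lines\<close>

text \<open>Minima of lines are generated inductively so that closure under sums, nonnegative
  multiples and finite minima follows by rule induction; \<open>envelope_lines\<close> recovers the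
  explicit finite set of lines.\<close>

inductive envelope :: "(real \<Rightarrow> real) \<Rightarrow> bool" where
  line: "envelope (\<lambda>y. a + b * y)"
| min: "\<lbrakk>envelope f; envelope g\<rbrakk> \<Longrightarrow> envelope (\<lambda>y. min (f y) (g y))"

lemma envelope_const: "envelope (\<lambda>y. a)"
  using envelope.line[of a 0] by simp

lemma envelope_id: "envelope (\<lambda>y. y)"
  using envelope.line[of 0 1] by simp

lemma envelope_add:
  assumes "envelope f" "envelope g"
  shows "envelope (\<lambda>y. f y + g y)"
  using assms
proof (induction f rule: envelope.induct)
  case (line a b)
  then show ?case
  proof (induction g rule: envelope.induct)
    case (line a' b')
    have "(\<lambda>y. a + b * y + (a' + b' * y)) = (\<lambda>y. (a + a') + (b + b') * y)"
      by (simp add: algebra_simps fun_eq_iff)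
    then show ?case by (simp only: envelope.line)
  next
    case (min f g)
    have "(\<lambda>y. a + b * y + min (f y) (g y)) = (\<lambda>y. min (a + b * y + f y) (a + b * y + g y))"
      by (simp add: fun_eq_iff min_add_distrib_right)
    then show ?case using min by (simp only: envelope.min)
  qed
next
  case (min f h)
  have "(\<lambda>y. min (f y) (h y) + g y) = (\<lambda>y. min (f y + g y) (h y + g y))"
    by (simp add: fun_eq_iff min_add_distrib_left)
  then show ?case using min by (simp only: envelope.min)
qed

lemma envelope_scale:
  assumes "envelope f" "0 \<le> c"
  shows "envelope (\<lambda>y. c * f y)"
  using assms
proof (induction f rule: envelope.induct)
  case (line a b)
  have "(\<lambda>y. c * (a + b * y)) = (\<lambda>y. c * a + (c * b) * y)"
    by (simp add: algebra_simps)
  then show ?case by (simp only: envelope.line)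
next
  case (min f g)
  have "(\<lambda>y. c * min (f y) (g y)) = (\<lambda>y. min (c * f y) (c * g y))"
    using min.prems by (simp add: fun_eq_iff min_mult_distrib_left)
  then show ?case using min by (simp only: envelope.min)
qed

lemma envelope_sum:
  assumes "finite A" "\<And>x. x \<in> A \<Longrightarrow> envelope (f x)"
  shows "envelope (\<lambda>y. \<Sum>x\<in>A. f x y)"
  using assms by (induction A rule: finite_induct) (auto intro: envelope_const envelope_add)

lemma envelope_Min:
  assumes "finite A" "A \<noteq> {}" "\<And>x. x \<in> A \<Longrightarrow> envelope (f x)"
  shows "envelope (\<lambda>y. Min ((\<lambda>x. f x y) ` A))"
  using assms by (induction A rule: finite_ne_induct) (auto intro: envelope.min)

lemma envelope_lines:
  assumes "envelope f"
  shows "\<exists>L. finite L \<and> L \<noteq> {} \<and> (\<forall>y. f y = Min ((\<lambda>(a, b). a + b * y) ` L))"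
  using assms
proof (induction f rule: envelope.induct)
  case (line a b)
  show ?case by (rule exI[of _ "{(a, b)}"]) simp
next
  case (min f g)
  then obtain L K where "finite L" "L \<noteq> {}" "\<forall>y. f y = Min ((\<lambda>(a, b). a + b * y) ` L)"
    and "finite K" "K \<noteq> {}" "\<forall>y. g y = Min ((\<lambda>(a, b). a + b * y) ` K)"
    by auto
  then show ?case by (intro exI[of _ "L \<union> K"]) (simp add: image_Un Min_Un)
qed

text \<open>A concave piecewise linear function bends only downwards, so it is a line plus
  nonnegative multiples of hinges \<open>min y w\<close>. Lines are inserted in order of
  nonincreasing slope; the statement keeps \<beta> among their slopes so that the next line is known
  to have slope at most \<beta>.\<close>

lemma lines_hinges:
  fixes L :: "(real \<times> real) set"
  assumes "finite L" "L \<noteq> {}"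
  shows "\<exists>\<alpha> \<beta> n \<delta> w. \<beta> \<in> snd ` L \<and> (\<forall>j<n::nat. 0 \<le> \<delta> j) \<and>
    (\<forall>y. Min ((\<lambda>(a, b). a + b * y) ` L) = \<alpha> + \<beta> * y + (\<Sum>j<n. \<delta> j * min y (w j)))"
  using assms
proof (induction L rule: finite_ranking_induct[where f = "\<lambda>l. - snd l"])
  case empty
  then show ?case by simp
next
  case (insert l L)
  obtain a b where l: "l = (a, b)" by force
  show ?case
  proof (cases "L = {}")
    case True
    show ?thesis unfolding True l
      by (rule exI[of _ a], rule exI[of _ b], rule exI[of _ 0]) simp
  next
    case False
    define g where "g y = Min ((\<lambda>(a, b). a + b * y) ` L)" for y
    from insert False obtain \<alpha> \<beta> n \<delta> w where \<beta>: "\<beta> \<in> snd ` L"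
      and \<delta>: "\<forall>j<n::nat. 0 \<le> \<delta> j"
      and g: "\<And>y. g y = \<alpha> + \<beta> * y + (\<Sum>j<n. \<delta> j * min y (w j))"
      unfolding g_def by blast
    have b: "b \<le> \<beta>" using \<beta> insert.hyps l by auto
    have eq: "Min ((\<lambda>(a, b). a + b * y) ` insert l L) = min (a + b * y) (g y)" for y
      unfolding g_def using False insert.hyps l by simp
    \<comment> \<open>The gap to the new line is nondecreasing, since g rises at least as fast as
      that line; so it either keeps one sign or crosses zero.\<close>
    define d where "d y = g y - (a + b * y)" for y
    have d_mono: "d y \<le> d y'" if "y \<le> y'" for y y'
    proof -
      have "(\<Sum>j<n. \<delta> j * min y (w j)) \<le> (\<Sum>j<n. \<delta> j * min y' (w j))"
        using \<delta> that by (intro sum_mono mult_left_mono) auto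
      moreover have "(\<beta> - b) * y \<le> (\<beta> - b) * y'" using b that by (intro mult_left_mono) auto
      ultimately show ?thesis unfolding d_def g by (simp add: algebra_simps)
    qed
    consider (below) "\<forall>y. d y \<le> 0" | (above) "\<forall>y. 0 \<le> d y"
      | (cross) y1 y2 where "d y1 < 0" "0 < d y2" by (meson not_le)
    then show ?thesis
    proof cases
      case below
      then have "min (a + b * y) (g y) = g y" for y by (intro min_absorb2) (simp add: d_def)
      with \<beta> \<delta> show ?thesis unfolding eq
        by - (rule exI[of _ \<alpha>], rule exI[of _ \<beta>], rule exI[of _ n], rule exI[of _ \<delta>],
            rule exI[of _ w], simp add: g)
    next
      case above
      then have "min (a + b * y) (g y) = a + b * y" for y by (intro min_absorb1) (simp add: d_def)
      then show ?thesis unfolding l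
        by - (rule exI[of _ a], rule exI[of _ b], rule exI[of _ 0], simp only: eq[unfolded l], simp)
    next
      case cross
      have "y1 \<le> y2" using cross d_mono[of y2 y1] by linarith
      moreover have "continuous_on {y1..y2} d" unfolding d_def g
        by (intro continuous_intros)
      ultimately obtain z where z: "d z = 0" using IVT'[of d y1 0 y2] cross by auto
      \<comment> \<open>Left of z the minimum follows g, right of z the new line. Hence the old
        hinges are truncated at z, and a new hinge at z, with index n and weight \<beta> - b,
        accounts for the drop in slope.\<close>
      have "min (a + b * y) (g y) =
        \<alpha> + b * y + (\<Sum>j<Suc n. (\<delta>(n := \<beta> - b)) j * min y (if j < n then min z (w j) else z))" for y
      proof -
        have "min (a + b * y) (g y) = g (min y z) + b * (y - min y z)"
          using d_mono[of y z] d_mono[of z y] z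
          by (cases "y \<le> z") (auto simp: d_def min_def algebra_simps)
        also have "\<dots> = \<alpha> + b * y + ((\<Sum>j<n. \<delta> j * min y (min z (w j))) + (\<beta> - b) * min y z)"
          unfolding g by (simp add: algebra_simps min.assoc)
        finally show ?thesis by (simp add: algebra_simps)
      qed
      moreover have "\<forall>j<Suc n. 0 \<le> (\<delta>(n := \<beta> - b)) j" using \<delta> b by auto
      ultimately show ?thesis unfolding l
        by - (rule exI[of _ \<alpha>], rule exI[of _ b], rule exI[of _ "Suc n"],
            rule exI[of _ "\<delta>(n := \<beta> - b)"],
            rule exI[of _ "\<lambda>j. if j < n then min z (w j) else z"], simp only: eq[unfolded l],
              simp del: sum.lessThan_Suc)
    qed
  qed
qed

section \<open>Functions of the form E min(y, w)\<close>

definition min_mean :: "real pmf \<Rightarrow> real \<Rightarrow> real" where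
  "min_mean p y = measure_pmf.expectation p (min y)"

lemma envelope_min_mean:
  assumes "finite (set_pmf p)"
  shows "envelope (min_mean p)"
proof -
  have "min_mean p = (\<lambda>y. \<Sum>w\<in>set_pmf p. pmf p w * min y w)"
    unfolding min_mean_def
    by (subst integral_measure_pmf_real[OF assms]) (auto simp: mult.commute)
  moreover have "envelope (\<lambda>y. \<Sum>w\<in>set_pmf p. pmf p w * min y w)"
    by (intro envelope_sum assms envelope_scale envelope.min envelope_id envelope_const) auto
  ultimately show ?thesis by simp
qed

text \<open>The hinge weights serve as probabilities: constancy to the right forces \<beta> = 0, and
  the identity to the left forces total weight 1 and \<alpha> = 0.\<close>

lemma envelope_eq_min_mean:
  assumes "envelope g" and low: "\<And>y. y \<le> l \<Longrightarrow> g y = y" and high: "\<And>y. u \<le> y \<Longrightarrow> g y = K"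
  shows "\<exists>p. finite (set_pmf p) \<and> min_mean p = g"
proof -
  obtain \<alpha> \<beta> \<delta> w and n :: nat where \<delta>: "\<forall>j<n. 0 \<le> \<delta> j"
    and g: "\<And>y. g y = \<alpha> + \<beta> * y + (\<Sum>j<n. \<delta> j * min y (w j))"
  proof -
    obtain L where L: "finite L" "L \<noteq> {}" "\<And>y. g y = Min ((\<lambda>(a, b). a + b * y) ` L)"
      using envelope_lines[OF assms(1)] by blast
    then show ?thesis using lines_hinges[OF L(1,2)] that by (simp only: L(3)[symmetric]) blast
  qed
  \<comment> \<open>To the left of a every hinge equals y and g is the identity; to the right of b
    every hinge is constant and g equals K.\<close>
  define a where "a = Min (insert l (w ` {..<n}))"
  define b where "b = Max (insert u (w ` {..<n}))"
  have a: "a \<le> l" "\<And>j. j < n \<Longrightarrow> a \<le> w j" unfolding a_def by auto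
  have b: "u \<le> b" "\<And>j. j < n \<Longrightarrow> w j \<le> b" unfolding b_def by auto
  have "g y = \<alpha> + \<beta> * y + (\<Sum>j<n. \<delta> j * w j)" if "b \<le> y" for y
  proof -
    have "(\<Sum>j<n. \<delta> j * min y (w j)) = (\<Sum>j<n. \<delta> j * w j)"
      using order_trans[OF b(2) that] by (intro sum.cong refl) (simp add: min_absorb2)
    then show ?thesis unfolding g by simp
  qed
  from this[of b] this[of "b + 1"] have \<beta>: "\<beta> = 0"
    using high[of b] high[of "b + 1"] b(1) by (simp add: algebra_simps)
  have "g y = \<alpha> + (\<Sum>j<n. \<delta> j) * y" if "y \<le> a" for y
  proof -
    have "(\<Sum>j<n. \<delta> j * min y (w j)) = (\<Sum>j<n. \<delta> j * y)"
      using order_trans[OF that a(2)] by (intro sum.cong refl) (simp add: min_absorb1)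
    then show ?thesis unfolding g \<beta> by (simp add: sum_distrib_right)
  qed
  from this[of a] this[of "a - 1"] have s: "(\<Sum>j<n. \<delta> j) = 1" and \<alpha>: "\<alpha> = 0"
    using low[of a] low[of "a - 1"] a(1) by (auto simp add: algebra_simps)
  \<comment> \<open>The law is placed on the indices first, as thresholds \<open>w j\<close> may
    coincide; mapping by w merges their masses.\<close>
  define q where "q = embed_pmf (\<lambda>j. if j < n then \<delta> j else 0)"
  have "(\<integral>\<^sup>+ j. ennreal (if j < n then \<delta> j else 0) \<partial>count_space UNIV)
      = (\<Sum>j<n. ennreal (\<delta> j))"
    by (subst nn_integral_count_space'[of "{..<n}"]) auto
  also have "\<dots> = 1" using \<delta> s by (subst sum_ennreal) auto
  finally have q: "pmf q j = (if j < n then \<delta> j else 0)" for j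
    unfolding q_def using \<delta> by (intro pmf_embed_pmf) auto
  then have sq: "set_pmf q \<subseteq> {..<n}" by (auto simp: set_pmf_eq split: if_splits)
  have "min_mean (map_pmf w q) y = g y" for y
  proof -
    have "min_mean (map_pmf w q) y = (\<Sum>j<n. min y (w j) * pmf q j)"
      unfolding min_mean_def integral_map_pmf using sq
      by (intro integral_measure_pmf_real) auto
    then show ?thesis unfolding g \<alpha> \<beta> q by (simp add: mult.commute)
  qed
  moreover have "finite (set_pmf (map_pmf w q))" using sq finite_subset by auto
  ultimately show ?thesis by blast
qed

lemma min_mean_low:
  assumes "\<And>w. w \<in> set_pmf p \<Longrightarrow> y \<le> w"
  shows "min_mean p y = y"
proof -
  have "min_mean p y = measure_pmf.expectation p (\<lambda>_. y)"
    unfolding min_mean_def using assms by (intro integral_cong_AE) (auto simp: AE_measure_pmf_iff)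
  then show ?thesis by simp
qed

lemma min_mean_high:
  assumes "\<And>w. w \<in> set_pmf p \<Longrightarrow> w \<le> y"
  shows "min_mean p y = measure_pmf.expectation p (\<lambda>w. w)"
  unfolding min_mean_def using assms by (intro integral_cong_AE) (auto simp: AE_measure_pmf_iff)

text \<open>The right-hand side is an envelope in y. Below all support points every action yields
  \<open>c a + y\<close>, which is at least y as costs are nonnegative; above them every action
  yields a constant. So \<open>envelope_eq_min_mean\<close> applies.\<close>

lemma exists_bellman_pmf:
  assumes A: "finite A" "A \<noteq> {}" and c: "\<And>a. a \<in> A \<Longrightarrow> 0 \<le> c a"
    and q: "\<And>a. a \<in> A \<Longrightarrow> finite (set_pmf (q a))"
  shows "\<exists>p. finite (set_pmf p) \<and>
    (\<forall>y. min_mean p y = Min (insert y ((\<lambda>a. c a + min_mean (q a) y) ` A)))"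
proof -
  define g where "g y = Min (insert y ((\<lambda>a. c a + min_mean (q a) y) ` A))" for y
  define U where "U = (\<Union>a\<in>A. set_pmf (q a))"
  define K where "K = Min ((\<lambda>a. c a + measure_pmf.expectation (q a) (\<lambda>w. w)) ` A)"
  have U: "finite U" "U \<noteq> {}" using A q by (auto simp: U_def set_pmf_not_empty)
  have g_min: "g y = min y (Min ((\<lambda>a. c a + min_mean (q a) y) ` A))" for y
    unfolding g_def using A by simp
  have "envelope (\<lambda>y. min y (Min ((\<lambda>a. c a + min_mean (q a) y) ` A)))"
    by (intro envelope.min envelope_id envelope_Min A envelope_add envelope_const
        envelope_min_mean q)
  then have "envelope g" unfolding g_min[abs_def] .
  moreover have "g y = y" if "y \<le> Min U" for y
  proof -
    have "min_mean (q a) y = y" if "a \<in> A" for a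
      using \<open>y \<le> Min U\<close> U that by (intro min_mean_low) (auto simp: U_def)
    then show ?thesis unfolding g_min using A c by (simp add: min_def)
  qed
  \<comment> \<open>From \<open>Max U\<close> on the actions do not depend on y, and from K on the
    outside option is no better than the best action.\<close>
  moreover have "g y = K" if "max K (Max U) \<le> y" for y
  proof -
    have "min_mean (q a) y = measure_pmf.expectation (q a) (\<lambda>w. w)" if "a \<in> A" for a
      using \<open>max K (Max U) \<le> y\<close> U that by (intro min_mean_high) (auto simp: U_def)
    then have "Min ((\<lambda>a. c a + min_mean (q a) y) ` A) = K"
      unfolding K_def by (intro arg_cong[of _ _ Min] image_cong) auto
    then show ?thesis unfolding g_min using that by simp
  qed
  ultimately obtain p where "finite (set_pmf p)" "min_mean p = g"
    using envelope_eq_min_mean by metis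
  then show ?thesis unfolding g_def by (intro exI[of _ p]) auto
qed


section \<open>Surrogate laws of states\<close>

lemma finite_set_bind_pmf:
  assumes "finite (set_pmf p)" "\<And>x. x \<in> set_pmf p \<Longrightarrow> finite (set_pmf (f x))"
  shows "finite (set_pmf (bind_pmf p f))"
  using assms by (simp add: set_bind_pmf)

lemma expectation_bind_pmf:
  fixes h :: "'b \<Rightarrow> real"
  assumes "finite (set_pmf p)" "\<And>x. x \<in> set_pmf p \<Longrightarrow> finite (set_pmf (f x))"
  shows "measure_pmf.expectation (bind_pmf p f) h =
    (\<Sum>x\<in>set_pmf p. pmf p x * measure_pmf.expectation (f x) h)"
  using pmf_expectation_bind[of "set_pmf p" f p h] assms by simp

lemma expectation_map_pmf_add:
  fixes h :: "'b \<Rightarrow> real"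
  assumes "finite (set_pmf p)" "\<And>x. x \<in> set_pmf p \<Longrightarrow> h (g x) = c + h' x"
  shows "measure_pmf.expectation (map_pmf g p) h = c + measure_pmf.expectation p h'"
proof -
  have "measure_pmf.expectation (map_pmf g p) h = measure_pmf.expectation p (\<lambda>x. c + h' x)"
    unfolding integral_map_pmf using assms(2)
    by (intro integral_cong_AE) (auto simp: AE_measure_pmf_iff)
  also have "\<dots> = c + measure_pmf.expectation p h'"
    using integrable_measure_pmf_finite[OF assms(1), of h'] by simp
  finally show ?thesis .
qed

lemma min_mean_bind_pmf:
  assumes "finite (set_pmf p)" "\<And>x. x \<in> set_pmf p \<Longrightarrow> finite (set_pmf (f x))"
  shows "min_mean (bind_pmf p f) y = (\<Sum>x\<in>set_pmf p. pmf p x * min_mean (f x) y)"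
  unfolding min_mean_def by (rule expectation_bind_pmf[OF assms])

section \<open>Recursion over the states of an MDP\<close>

lemma mdp_finite_trans:
  assumes "costly_information_mdp M" "s \<in> states M - terminals M" "a \<in> actions M s"
  shows "finite (set_pmf (trans M s a))" "set_pmf (trans M s a) \<subseteq> states M" "0 \<le> cost M a"
proof -
  show "set_pmf (trans M s a) \<subseteq> states M" "0 \<le> cost M a"
    using assms unfolding costly_information_mdp_def by auto
  then show "finite (set_pmf (trans M s a))"
    using assms(1) finite_subset unfolding costly_information_mdp_def by blast
qed

text \<open>Successors count as smaller, which allows backward induction from the terminals.\<close>

lemma mdp_wf:
  assumes "costly_information_mdp M"
  shows "wf ((succ_rel M)\<inverse>)"
proof -
  have "succ_rel M \<subseteq> states M \<times> states M"
    using assms mdp_finite_trans(2)[OF assms] by (auto simp: succ_rel_def)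
  then have "finite (succ_rel M)"
    using assms finite_subset unfolding costly_information_mdp_def by blast
  then show ?thesis
    using assms finite_acyclic_wf_converse unfolding costly_information_mdp_def by blast
qed

text \<open>The Bellman equation of the local game, with a single law per state serving all outside
  options y at once. The terminal values u are a parameter in order to carry the sign.\<close>

definition is_potential :: "('s, 'a) mdp \<Rightarrow> ('s \<Rightarrow> real) \<Rightarrow> ('s \<Rightarrow> real pmf) \<Rightarrow> bool" where
  "is_potential M u f \<longleftrightarrow> (\<forall>s. finite (set_pmf (f s)) \<and>
     (s \<in> terminals M \<longrightarrow> f s = return_pmf (u s)) \<and>
     (s \<in> states M - terminals M \<longrightarrow> (\<forall>y. min_mean (f s) y =
        Min (insert y ((\<lambda>a. cost M a + min_mean (bind_pmf (trans M s a) f) y) ` actions M s)))))"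

definition potential :: "('s, 'a) mdp \<Rightarrow> ('s \<Rightarrow> real) \<Rightarrow> 's \<Rightarrow> real pmf" where
  "potential M u = (SOME f. is_potential M u f)"

text \<open>Well-founded choice: the condition at s refers to f only at successors of s, and
  \<open>exists_bellman_pmf\<close> supplies a law that meets it.\<close>

lemma potential:
  fixes M :: "('s, 'a) mdp"
  assumes M: "costly_information_mdp M"
  shows "is_potential M u (potential M u)"
  unfolding potential_def
proof (rule someI_ex[where P = "is_potential M u"])
  let ?B = "\<lambda>f s y. Min (insert y
    ((\<lambda>a. cost M a + min_mean (bind_pmf (trans M s a) f) y) ` actions M s))"
  show "\<exists>f. is_potential M u f"
    unfolding is_potential_def
  proof (rule dependent_wf_choice[OF mdp_wf[OF M], where P = "\<lambda>f s p. finite (set_pmf p) \<and>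
      (s \<in> terminals M \<longrightarrow> p = return_pmf (u s)) \<and>
      (s \<in> states M - terminals M \<longrightarrow> (\<forall>y. min_mean p y = ?B f s y))"])
    fix f g :: "'s \<Rightarrow> real pmf" and s p
    assume fg: "\<And>z. (z, s) \<in> (succ_rel M)\<inverse> \<Longrightarrow> f z = g z"
    have "?B f s y = ?B g s y" if "s \<in> states M - terminals M" for y
    proof -
      have "bind_pmf (trans M s a) f = bind_pmf (trans M s a) g" if "a \<in> actions M s" for a
        using \<open>s \<in> _\<close> that by (intro bind_pmf_cong refl fg) (auto simp: succ_rel_def)
      then have "(\<lambda>a. cost M a + min_mean (bind_pmf (trans M s a) f) y) ` actions M s
        = (\<lambda>a. cost M a + min_mean (bind_pmf (trans M s a) g) y) ` actions M s"
        by (intro image_cong) auto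
      then show ?thesis by simp
    qed
    then show "(finite (set_pmf p) \<and> (s \<in> terminals M \<longrightarrow> p = return_pmf (u s)) \<and>
        (s \<in> states M - terminals M \<longrightarrow> (\<forall>y. min_mean p y = ?B f s y))) =
      (finite (set_pmf p) \<and> (s \<in> terminals M \<longrightarrow> p = return_pmf (u s)) \<and>
        (s \<in> states M - terminals M \<longrightarrow> (\<forall>y. min_mean p y = ?B g s y)))"
      by simp
  next
    fix s and f :: "'s \<Rightarrow> real pmf"
    assume IH: "\<And>t. (t, s) \<in> (succ_rel M)\<inverse> \<Longrightarrow> finite (set_pmf (f t)) \<and>
      (t \<in> terminals M \<longrightarrow> f t = return_pmf (u t)) \<and>
      (t \<in> states M - terminals M \<longrightarrow> (\<forall>y. min_mean (f t) y = ?B f t y))"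
    show "\<exists>p. finite (set_pmf p) \<and> (s \<in> terminals M \<longrightarrow> p = return_pmf (u s)) \<and>
      (s \<in> states M - terminals M \<longrightarrow> (\<forall>y. min_mean p y = ?B f s y))"
    proof (cases "s \<in> states M - terminals M")
      \<comment> \<open>This covers terminals, where the law is prescribed, and points outside the
        state space, where it is a default.\<close>
      case False
      then show ?thesis by (intro exI[of _ "return_pmf (u s)"]) auto
    next
      case True
      have "finite (set_pmf (bind_pmf (trans M s a) f))" if "a \<in> actions M s" for a
        using IH mdp_finite_trans[OF M True that] that True
        by (intro finite_set_bind_pmf) (auto simp: succ_rel_def)
      moreover have "finite (actions M s)" "actions M s \<noteq> {}"
        using M True unfolding costly_information_mdp_def by auto
      ultimately obtain p where "finite (set_pmf p)" "\<forall>y. min_mean p y = ?B f s y"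
        using exists_bellman_pmf[of "actions M s" "cost M" "\<lambda>a. bind_pmf (trans M s a) f"]
          mdp_finite_trans(3)[OF M True] by auto
      with True show ?thesis by blast
    qed
  qed
qed

lemma finite_potential:
  "costly_information_mdp M \<Longrightarrow> finite (set_pmf (potential M u s))"
  using potential[of M u] unfolding is_potential_def by blast

lemma potential_terminal:
  "\<lbrakk>costly_information_mdp M; s \<in> terminals M\<rbrakk> \<Longrightarrow> potential M u s = return_pmf (u s)"
  using potential[of M u] unfolding is_potential_def by blast

lemma potential_bellman:
  assumes M: "costly_information_mdp M" and s: "s \<in> states M - terminals M"
  shows "min_mean (potential M u s) y = Min (insert y ((\<lambda>a. cost M a +
    (\<Sum>t\<in>set_pmf (trans M s a). pmf (trans M s a) t * min_mean (potential M u t) y)) ` actions M s))"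
proof -
  have "min_mean (potential M u s) y = Min (insert y ((\<lambda>a. cost M a +
    min_mean (bind_pmf (trans M s a) (potential M u)) y) ` actions M s))"
    using potential[OF M, of u] s unfolding is_potential_def by blast
  also have "(\<lambda>a. cost M a + min_mean (bind_pmf (trans M s a) (potential M u)) y) ` actions M s
    = (\<lambda>a. cost M a + (\<Sum>t\<in>set_pmf (trans M s a).
        pmf (trans M s a) t * min_mean (potential M u t) y)) ` actions M s"
    using mdp_finite_trans(1)[OF M s] finite_potential[OF M]
    by (intro image_cong refl) (simp add: min_mean_bind_pmf)
  finally show ?thesis .
qed

text \<open>This half of the Bellman equation holds for every available action, as a global policy
  calls for: its actions may be suboptimal in the local game.\<close>

lemma potential_step:
  assumes M: "costly_information_mdp M" and s: "s \<in> states M - terminals M"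
    and a: "a \<in> actions M s"
  shows "min_mean (potential M u s) y \<le> cost M a +
    (\<Sum>t\<in>set_pmf (trans M s a). pmf (trans M s a) t * min_mean (potential M u t) y)"
proof -
  have "finite (actions M s)" using M s unfolding costly_information_mdp_def by auto
  then show ?thesis unfolding potential_bellman[OF M s] using a by (intro Min_le) auto
qed

section \<open>The local game and its Bellman value\<close>

lemma exists_local_policy:
  assumes M: "costly_information_mdp M" and "s \<in> states M"
  shows "\<exists>\<pi>. local_valid M s \<pi> \<and> finite (set_pmf (local_play M y \<pi> s)) \<and>
    measure_pmf.expectation (local_play M y \<pi> s) (\<lambda>(x, c). \<sigma> * x + c) =
      min_mean (potential M (\<lambda>s. \<sigma> * val M s) s) (\<sigma> * y)"
  using assms(2)
proof (induction s rule: wf_induct_rule[OF mdp_wf[OF M]])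
  case (1 s)
  let ?u = "\<lambda>s. \<sigma> * val M s"
  let ?g = "\<lambda>s. min_mean (potential M ?u s) (\<sigma> * y)"
  let ?ok = "\<lambda>s \<pi>. local_valid M s \<pi> \<and> finite (set_pmf (local_play M y \<pi> s)) \<and>
    measure_pmf.expectation (local_play M y \<pi> s) (\<lambda>(x, c). \<sigma> * x + c) = ?g s"
  have outside: ?case if "?g s = \<sigma> * y"
    using that by (intro exI[of _ L_Outside]) (auto intro: local_valid.intros)
  show ?case
  proof (cases "s \<in> terminals M")
    case True
    then have g: "?g s = min (\<sigma> * y) (\<sigma> * val M s)"
      by (simp add: potential_terminal[OF M] min_mean_def)
    show ?thesis
    proof (cases "\<sigma> * y \<le> \<sigma> * val M s")
      case True
      then show ?thesis using outside g by simp
    next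
      case False
      then show ?thesis using g \<open>s \<in> terminals M\<close>
        by (intro exI[of _ L_Accept]) (auto intro: local_valid.intros)
    qed
  next
    case False
    then have s: "s \<in> states M - terminals M" using 1 by simp
    have A: "finite (actions M s)" using M s unfolding costly_information_mdp_def by auto
    let ?Q = "\<lambda>a. cost M a + (\<Sum>t\<in>set_pmf (trans M s a). pmf (trans M s a) t * ?g t)"
    \<comment> \<open>The minimum is attained, either by taking the outside option or by an action
      after which the policies of the successors are followed.\<close>
    have "?g s \<in> insert (\<sigma> * y) (?Q ` actions M s)"
      unfolding potential_bellman[OF M s] using A by (intro Min_in) auto
    then consider "?g s = \<sigma> * y" | a where "a \<in> actions M s" "?g s = ?Q a" by auto
    then show ?thesis
    proof cases
      case 1
      then show ?thesis by (rule outside)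
    next
      case (2 a)
      note tr = mdp_finite_trans[OF M s 2(1)]
      have "\<forall>t\<in>set_pmf (trans M s a). \<exists>\<pi>. ?ok t \<pi>"
        using 1(1) s 2(1) tr(2) by (auto simp: succ_rel_def)
      then obtain k where k: "\<And>t. t \<in> set_pmf (trans M s a) \<Longrightarrow> ?ok t (k t)" by metis
      let ?\<pi> = "L_Advance a k"
      have "local_valid M s ?\<pi>" using s 2(1) k by (intro local_valid.intros) auto
      moreover have "finite (set_pmf (local_play M y ?\<pi> s))"
        using k tr(1) by (auto intro!: finite_set_bind_pmf)
      moreover have "measure_pmf.expectation (local_play M y ?\<pi> s) (\<lambda>(x, c). \<sigma> * x + c) = ?g s"
      proof -
        have "measure_pmf.expectation (local_play M y ?\<pi> s) (\<lambda>(x, c). \<sigma> * x + c) =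
          (\<Sum>t\<in>set_pmf (trans M s a). pmf (trans M s a) t *
            measure_pmf.expectation (map_pmf (\<lambda>(x, c). (x, cost M a + c)) (local_play M y (k t) t))
              (\<lambda>(x, c). \<sigma> * x + c))"
          using k tr(1) by (simp add: expectation_bind_pmf)
        also have "\<dots> = (\<Sum>t\<in>set_pmf (trans M s a). pmf (trans M s a) t * (cost M a + ?g t))"
        proof (intro sum.cong refl)
          fix t assume t: "t \<in> set_pmf (trans M s a)"
          have "measure_pmf.expectation (map_pmf (\<lambda>(x, c). (x, cost M a + c)) (local_play M y (k t) t))
              (\<lambda>(x, c). \<sigma> * x + c) = cost M a +
              measure_pmf.expectation (local_play M y (k t) t) (\<lambda>(x, c). \<sigma> * x + c)"
            using k[OF t] by (intro expectation_map_pmf_add) auto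
          with k[OF t] show "pmf (trans M s a) t * measure_pmf.expectation
              (map_pmf (\<lambda>(x, c). (x, cost M a + c)) (local_play M y (k t) t)) (\<lambda>(x, c). \<sigma> * x + c)
            = pmf (trans M s a) t * (cost M a + ?g t)" by simp
        qed
        also have "\<dots> = ?Q a"
          using tr(1) by (simp add: distrib_left sum.distrib flip: sum_distrib_right)
            (simp add: sum_pmf_eq_1)
        finally show ?thesis using 2(2) by simp
      qed
      ultimately show ?thesis by blast
    qed
  qed
qed

text \<open>Accepted values are bounded below by b and costs are nonnegative, so b bounds every
  outcome. The finite support makes outcomes integrable, and b then bounds their
  expectations.\<close>

lemma local_play_bound:
  assumes M: "costly_information_mdp M" and "local_valid M s \<pi>" "s \<in> states M"
    and b: "b \<le> \<sigma> * y" "\<And>s. s \<in> states M \<Longrightarrow> b \<le> \<sigma> * val M s"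
  shows "finite (set_pmf (local_play M y \<pi> s)) \<and>
    (\<forall>(x, c)\<in>set_pmf (local_play M y \<pi> s). b \<le> \<sigma> * x + c)"
  using assms(2,3)
proof (induction s \<pi> rule: local_valid.induct)
  case (outside s)
  then show ?case using b by simp
next
  case (accept s)
  then show ?case using b by simp
next
  case (advance s a k)
  note tr = mdp_finite_trans[OF M advance(1,2)]
  have IH: "finite (set_pmf (local_play M y (k t) t)) \<and>
    (\<forall>(x, c)\<in>set_pmf (local_play M y (k t) t). b \<le> \<sigma> * x + c)"
    if "t \<in> set_pmf (trans M s a)" for t
    using that advance tr(2) by blast
  have "b \<le> \<sigma> * x + (cost M a + c)"
    if "t \<in> set_pmf (trans M s a)" "(x, c) \<in> set_pmf (local_play M y (k t) t)" for t x c
    using IH[OF that(1)] that(2) tr(3) by fastforce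
  then show ?case
    using IH tr(1) by (auto intro!: finite_set_bind_pmf simp: set_bind_pmf)
next
  case (random p s)
  then show ?case
    by (auto intro!: finite_set_bind_pmf simp: set_bind_pmf)
qed

lemma local_value_bdd_below:
  assumes M: "costly_information_mdp M"
  shows "bdd_below {measure_pmf.expectation (local_play M y \<pi> (start M)) (\<lambda>(x, c). \<sigma> * x + c) | \<pi>.
     local_valid M (start M) \<pi>}"
proof -
  define b where "b = Min (insert (\<sigma> * y) ((\<lambda>s. \<sigma> * val M s) ` states M))"
  have st: "finite (states M)" "start M \<in> states M"
    using M unfolding costly_information_mdp_def by auto
  have "b \<le> measure_pmf.expectation (local_play M y \<pi> (start M)) (\<lambda>(x, c). \<sigma> * x + c)"
    if "local_valid M (start M) \<pi>" for \<pi>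
  proof -
    have "finite (set_pmf (local_play M y \<pi> (start M))) \<and>
      (\<forall>(x, c)\<in>set_pmf (local_play M y \<pi> (start M)). b \<le> \<sigma> * x + c)"
      using st unfolding b_def by (intro local_play_bound[OF M that] Min_le) auto
    then show ?thesis
      by (intro measure_pmf.integral_ge_const integrable_measure_pmf_finite)
        (auto simp: AE_measure_pmf_iff)
  qed
  then show ?thesis by (intro bdd_belowI[of _ b]) auto
qed

text \<open>One policy attains the right-hand side; boundedness from below is what puts the real
  infimum below it.\<close>

lemma local_value_le_potential:
  assumes M: "costly_information_mdp M"
  shows "Inf {measure_pmf.expectation (local_play M y \<pi> (start M)) (\<lambda>(x, c). \<sigma> * x + c) | \<pi>.
     local_valid M (start M) \<pi>} \<le> min_mean (potential M (\<lambda>s. \<sigma> * val M s) (start M)) (\<sigma> * y)"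
proof -
  have "start M \<in> states M" using M unfolding costly_information_mdp_def by auto
  from exists_local_policy[OF M this, of y \<sigma>] show ?thesis
    by (auto intro!: cInf_lower2[OF _ _ local_value_bdd_below[OF M]])
qed

lemma local_min_le_potential:
  assumes "costly_information_mdp M"
  shows "local_min M y \<le> min_mean (potential M (val M) (start M)) y"
  using local_value_le_potential[OF assms, of y 1] by (simp add: local_min_def)

text \<open>The sign is -1: negated utilities are costs for terminal values \<open>- val\<close> and
  outside option \<open>- y\<close>, and the supremum becomes an infimum.\<close>

lemma local_max_ge_potential:
  assumes "costly_information_mdp M"
  shows "- local_max M y \<le> min_mean (potential M (\<lambda>s. - val M s) (start M)) (- y)"
proof -
  let ?S = "{measure_pmf.expectation (local_play M y \<pi> (start M)) (\<lambda>(x, c). x - c) | \<pi>.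
     local_valid M (start M) \<pi>}"
  have "measure_pmf.expectation q (\<lambda>(x, c). - x + c) = - measure_pmf.expectation q (\<lambda>(x, c). x - c)"
    for q :: "(real \<times> real) pmf"
    by (simp flip: Bochner_Integration.integral_minus add: case_prod_unfold)
  then have "uminus ` ?S = {measure_pmf.expectation (local_play M y \<pi> (start M))
      (\<lambda>(x, c). (-1) * x + c) | \<pi>. local_valid M (start M) \<pi>}"
    by auto
  moreover have "Inf (uminus ` ?S) = - Sup ?S"
    by (simp add: Inf_real_def image_image)
  ultimately show ?thesis
    using local_value_le_potential[OF assms, of y "-1"] by (simp add: local_max_def)
qed


section \<open>Exchanging one coordinate\<close>

text \<open>Laws with finite mean, general enough for both the finitely supported laws of states and
  the distributions of the surrogates.\<close>

definition integrable_law :: "real measure \<Rightarrow> bool" where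
  "integrable_law \<nu> \<longleftrightarrow> prob_space \<nu> \<and> sets \<nu> = sets borel \<and> integrable \<nu> (\<lambda>w. w)"

lemma integrable_law_measurable:
  "integrable_law \<nu> \<Longrightarrow> f \<in> borel_measurable borel \<Longrightarrow> f \<in> borel_measurable \<nu>"
  unfolding integrable_law_def by (metis measurable_cong_sets)

lemma integrable_law_min:
  assumes "integrable_law \<nu>"
  shows "integrable \<nu> (min y)"
proof -
  interpret prob_space \<nu> using assms unfolding integrable_law_def by blast
  have "integrable \<nu> (\<lambda>w. \<bar>y\<bar> + \<bar>w\<bar>)" using assms unfolding integrable_law_def by simp
  then show ?thesis
    by (rule Bochner_Integration.integrable_bound)
      (auto intro!: integrable_law_measurable[OF assms] simp: min_def)
qed

text \<open>Truncation at nonnegative levels is dominated by the absolute value of w, so truncated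
  means determine the mean.\<close>

lemma tendsto_integral_min:
  assumes "integrable_law \<nu>"
  shows "(\<lambda>n. \<integral>w. min (real n) w \<partial>\<nu>) \<longlonglongrightarrow> (\<integral>w. w \<partial>\<nu>)"
proof (rule integral_dominated_convergence[where w = "\<lambda>w. \<bar>w\<bar>"])
  have "(\<lambda>n. min (real n) w) \<longlonglongrightarrow> w" for w
  proof (rule tendsto_eventually)
    obtain k :: nat where "w \<le> real k" using real_arch_simple by blast
    then show "\<forall>\<^sub>F n in sequentially. min (real n) w = w"
      by (intro eventually_sequentiallyI[of k]) (auto simp: min_def)
  qed
  then show "AE w in \<nu>. (\<lambda>n. min (real n) w) \<longlonglongrightarrow> w" by simp
  show "integrable \<nu> (\<lambda>w. \<bar>w\<bar>)" using assms by (auto simp: integrable_law_def)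
  show "AE w in \<nu>. norm (min (real n) w) \<le> \<bar>w\<bar>" for n by (auto simp: min_def)
qed (rule integrable_law_measurable[OF assms], measurable)+

text \<open>B collects the indices of slope 1. With A the minimum of a over \<open>K - B\<close> and
  b that over \<open>K \<inter> B\<close>, the total is \<open>min A (b + w)\<close>, that is
  \<open>b + min (A - b) w\<close>; the other two cases arise when one part is empty.\<close>

lemma Min_affine_01:
  fixes a :: "'k \<Rightarrow> real"
  assumes "finite K" "K \<noteq> {}"
  obtains (const) A where "\<And>w. (MIN k\<in>K. a k + (if k \<in> B then w else 0)) = A"
  | (shift) b where "\<And>w. (MIN k\<in>K. a k + (if k \<in> B then w else 0)) = b + w"
  | (min) A b where "\<And>w. (MIN k\<in>K. a k + (if k \<in> B then w else 0)) = b + min (A - b) w"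
proof -
  let ?f = "\<lambda>w k. a k + (if k \<in> B then w else 0)"
  have out: "Min (?f w ` (K - B)) = Min (a ` (K - B))" for w
    by (intro arg_cong[of _ _ Min] image_cong) auto
  have ins: "Min (?f w ` (K \<inter> B)) = Min (a ` (K \<inter> B)) + w" if "K \<inter> B \<noteq> {}" for w
  proof -
    have "Min (?f w ` (K \<inter> B)) = Min ((\<lambda>k. a k + w) ` (K \<inter> B))"
      by (intro arg_cong[of _ _ Min] image_cong) auto
    also have "\<dots> = Min (a ` (K \<inter> B)) + w"
      using that assms by (intro Min_add_commute) auto
    finally show ?thesis .
  qed
  consider "K \<inter> B = {}" | "K - B = {}" | "K \<inter> B \<noteq> {}" "K - B \<noteq> {}" by blast
  then show thesis
  proof cases
    case 1
    then have "K - B = K" by blast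
    then show thesis using out const by metis
  next
    case 2
    then have "K \<inter> B = K" by blast
    then show thesis using ins assms shift by (metis add.commute)
  next
    case 3
    have "Min (?f w ` K) = Min (a ` (K \<inter> B)) + min (Min (a ` (K - B)) - Min (a ` (K \<inter> B))) w" for w
    proof -
      have "?f w ` K = ?f w ` (K - B) \<union> ?f w ` (K \<inter> B)" by blast
      then have "Min (?f w ` K) = min (Min (?f w ` (K - B))) (Min (?f w ` (K \<inter> B)))"
        using 3 assms by (simp only: Min_Un finite_imageI finite_Diff finite_Int image_is_empty simp_thms)
      then show ?thesis unfolding out ins[OF 3(1)] by (simp add: min_def algebra_simps)
    qed
    then show thesis using min by blast
  qed
qed

text \<open>The test functions \<open>min y\<close> suffice: a minimum of functions of slope 0 or 1 is a constant,
  a translation, or a constant plus one of them.\<close>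

lemma expectation_Min_affine_le:
  fixes a :: "'k \<Rightarrow> real"
  assumes K: "finite K" "K \<noteq> {}" and \<nu>: "integrable_law \<nu>" "\<And>t. t \<in> T \<Longrightarrow> integrable_law (\<mu> t)"
    and p: "(\<Sum>t\<in>T. p t) = 1" and c: "0 \<le> c"
    and le: "\<And>y. (\<integral>w. min y w \<partial>\<nu>) \<le> c + (\<Sum>t\<in>T. p t * (\<integral>w. min y w \<partial>\<mu> t))"
  shows "(\<integral>w. (MIN k\<in>K. a k + (if k \<in> B then w else 0)) \<partial>\<nu>)
    \<le> c + (\<Sum>t\<in>T. p t * (\<integral>w. (MIN k\<in>K. a k + (if k \<in> B then w else 0)) \<partial>\<mu> t))"
proof -
  have const_int: "(\<integral>w. x \<partial>\<nu>') = x" if "integrable_law \<nu>'" for \<nu>' and x :: real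
  proof -
    interpret prob_space \<nu>' using that unfolding integrable_law_def by blast
    show ?thesis by (simp add: prob_space)
  qed
  have add: "(\<integral>w. x + f w \<partial>\<nu>') = x + (\<integral>w. f w \<partial>\<nu>')"
    if "integrable_law \<nu>'" "integrable \<nu>' f" for \<nu>' f and x :: real
  proof -
    interpret prob_space \<nu>' using that unfolding integrable_law_def by blast
    show ?thesis using that(2) by (simp add: prob_space)
  qed
  \<comment> \<open>Weights that sum to 1 let a constant pass through the average, so offsets cancel
    between the two sides.\<close>
  have pull: "c + (\<Sum>t\<in>T. p t * (x + f t)) = x + (c + (\<Sum>t\<in>T. p t * f t))" for x f
    using p by (simp add: distrib_left sum.distrib flip: sum_distrib_right)
  from K show ?thesis
  proof (cases rule: Min_affine_01[where a = a and B = B])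
    case (const A)
    have "(\<Sum>t\<in>T. p t * (\<integral>w. A \<partial>\<mu> t)) = (\<Sum>t\<in>T. p t * A)"
      using const_int[OF \<nu>(2)] by (intro sum.cong) auto
    then show ?thesis unfolding const using const_int[OF \<nu>(1), of A] c p
      by (simp only: sum_distrib_right[symmetric])
  next
    case (shift b)
    \<comment> \<open>With slope 1 throughout there is no finite threshold; the hypothesis is taken
      at y = n and n tends to infinity.\<close>
    have "(\<lambda>n. c + (\<Sum>t\<in>T. p t * (\<integral>w. min (real n) w \<partial>\<mu> t)))
        \<longlonglongrightarrow> c + (\<Sum>t\<in>T. p t * (\<integral>w. w \<partial>\<mu> t))"
      using \<nu>(2) by (intro tendsto_intros tendsto_integral_min)
    then have "(\<integral>w. w \<partial>\<nu>) \<le> c + (\<Sum>t\<in>T. p t * (\<integral>w. w \<partial>\<mu> t))"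
      using le by (intro LIMSEQ_le[OF tendsto_integral_min[OF \<nu>(1)]]) auto
    then show ?thesis
      using \<nu> unfolding shift by (simp add: add integrable_law_def pull cong: sum.cong)
  next
    case (min A b)
    show ?thesis
      using \<nu> le[of "A - b"] unfolding min
      by (simp add: add integrable_law_min pull cong: sum.cong)
  qed
qed

section \<open>Product laws and best completions\<close>

lemma integral_PiM_insert:
  fixes f :: "('i \<Rightarrow> real) \<Rightarrow> real"
  assumes N: "\<And>i. prob_space (N i)" and f: "integrable (PiM (insert i J) N) f"
  shows "integrable (PiM J N) (\<lambda>x. \<integral>w. f (x(i := w)) \<partial>N i)"
    and "(\<integral>x. f x \<partial>PiM (insert i J) N) = (\<integral>x. (\<integral>w. f (x(i := w)) \<partial>N i) \<partial>PiM J N)"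
proof -
  interpret N: prob_space "N i" by (rule N)
  interpret P: prob_space "PiM J N" by (intro prob_space_PiM N)
  interpret pair_sigma_finite "N i" "PiM J N" ..
  \<comment> \<open>The product over \<open>insert i J\<close> is the image of a pair under updating
    coordinate i, so Fubini can put the integral over that coordinate innermost.\<close>
  have m: "(\<lambda>(w, x). x(i := w)) \<in> N i \<Otimes>\<^sub>M PiM J N \<rightarrow>\<^sub>M PiM (insert i J) N"
    by measurable
  note d = distr_pair_PiM_eq_PiM[of J N i, OF N N]
  have fm: "f \<in> borel_measurable (PiM (insert i J) N)" using f by auto
  have "integrable (N i \<Otimes>\<^sub>M PiM J N) (\<lambda>z. f ((\<lambda>(w, x). x(i := w)) z))"
    using f by (subst integrable_distr_eq[OF m fm, symmetric]) (simp add: d)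
  then have int: "integrable (N i \<Otimes>\<^sub>M PiM J N) (\<lambda>(w, x). f (x(i := w)))"
    by (simp add: case_prod_unfold)
  show "integrable (PiM J N) (\<lambda>x. \<integral>w. f (x(i := w)) \<partial>N i)"
    using integrable_snd[OF int] .
  have "(\<integral>x. f x \<partial>PiM (insert i J) N) = (\<integral>z. f ((\<lambda>(w, x). x(i := w)) z) \<partial>(N i \<Otimes>\<^sub>M PiM J N))"
    by (subst integral_distr[OF m fm, symmetric]) (simp add: d)
  also have "\<dots> = (\<integral>x. (\<integral>w. f (x(i := w)) \<partial>N i) \<partial>PiM J N)"
    using integral_snd[OF int] by (simp add: case_prod_unfold)
  finally show "(\<integral>x. f x \<partial>PiM (insert i J) N) = (\<integral>x. (\<integral>w. f (x(i := w)) \<partial>N i) \<partial>PiM J N)" .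
qed

text \<open>Coordinates in D are already paid for and drop out of the sum, while h still sees the
  whole set S.\<close>

definition best :: "nat set set \<Rightarrow> (nat set \<Rightarrow> real) \<Rightarrow> nat set \<Rightarrow> (nat \<Rightarrow> real) \<Rightarrow> real" where
  "best F h D w = (MIN S\<in>F. (\<Sum>i\<in>S - D. w i) + h S)"

lemma integrable_best:
  assumes J: "finite J" and F: "F \<subseteq> Pow J" "F \<noteq> {}" and N: "\<And>i. integrable_law (N i)"
  shows "integrable (PiM J N) (best F h D)"
proof -
  have fin: "finite F" "\<And>S. S \<in> F \<Longrightarrow> finite S"
    using F J finite_subset[of F "Pow J"] finite_subset[of _ J] by auto
  have prob: "prob_space (N i)" and [measurable_cong]: "sets (N i) = sets borel" for i
    using N unfolding integrable_law_def by auto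
  interpret prob_space "PiM J N" by (intro prob_space_PiM prob)
  have comp: "integrable (PiM J N) (\<lambda>w. w i)" if "i \<in> J" for i
  proof -
    have "integrable (distr (PiM J N) (N i) (\<lambda>w. w i)) (\<lambda>w. w)"
      using N[of i] that prob by (subst distr_PiM_component) (auto simp: integrable_law_def)
    then show ?thesis
      using that by (intro integrable_distr[of "\<lambda>w. w i"]) auto
  qed
  have meas: "best F h D \<in> borel_measurable (PiM J N)"
    unfolding best_def using F fin
    by (intro borel_measurable_Min borel_measurable_add borel_measurable_sum
        borel_measurable_const borel_measurable_integrable[OF comp]) auto
  \<comment> \<open>A sum of nonnegative terms over all sets of F dominates whichever of them
    attains the minimum.\<close>
  have "integrable (PiM J N) (\<lambda>w. \<Sum>S\<in>F. (\<Sum>i\<in>S - D. \<bar>w i\<bar>) + \<bar>h S\<bar>)"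
    using F fin by (intro Bochner_Integration.integrable_sum Bochner_Integration.integrable_add
        integrable_const integrable_abs comp) auto
  then show ?thesis
  proof (rule Bochner_Integration.integrable_bound[OF _ meas], intro AE_I2)
    fix w
    have "best F h D w \<in> (\<lambda>S. (\<Sum>i\<in>S - D. w i) + h S) ` F"
      unfolding best_def using F fin by (intro Min_in) auto
    then obtain S where S: "S \<in> F" "best F h D w = (\<Sum>i\<in>S - D. w i) + h S" by blast
    have "\<bar>best F h D w\<bar> \<le> (\<Sum>i\<in>S - D. \<bar>w i\<bar>) + \<bar>h S\<bar>"
      unfolding S(2) by (rule order_trans[OF abs_triangle_ineq]) (simp add: sum_abs)
    also have "\<dots> \<le> (\<Sum>S\<in>F. (\<Sum>i\<in>S - D. \<bar>w i\<bar>) + \<bar>h S\<bar>)"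
      using S(1) fin by (intro member_le_sum) (auto intro!: add_nonneg_nonneg sum_nonneg)
    finally show "norm (best F h D w) \<le> norm (\<Sum>S\<in>F. (\<Sum>i\<in>S - D. \<bar>w i\<bar>) + \<bar>h S\<bar>)"
      by simp
  qed
qed

text \<open>With the other coordinates fixed, \<open>best\<close> is in coordinate i a minimum of
  functions of slope 0 or 1, so \<open>expectation_Min_affine_le\<close> applies to each slice and
  Fubini integrates the result. The weights p and the cost c describe an action with its successors;
  a plain replacement of one law is the case of a single t and c = 0.\<close>

lemma integral_best_exchange:
  assumes J: "finite J" "i \<in> J" and F: "F \<subseteq> Pow J" "F \<noteq> {}"
    and N: "\<And>i. integrable_law (N i)" and \<mu>: "\<And>t. integrable_law (\<mu> t)"
    and p: "finite T" "(\<Sum>t\<in>T. p t) = 1" and c: "0 \<le> c"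
    and le: "\<And>y. (\<integral>w. min y w \<partial>N i) \<le> c + (\<Sum>t\<in>T. p t * (\<integral>w. min y w \<partial>\<mu> t))"
  shows "(\<integral>w. best F h D w \<partial>PiM J N)
    \<le> c + (\<Sum>t\<in>T. p t * (\<integral>w. best F h D w \<partial>PiM J (N(i := \<mu> t))))"
proof -
  define J' where "J' = J - {i}"
  have J': "J = insert i J'" using J by (auto simp: J'_def)
  have fin: "finite F" "\<And>S. S \<in> F \<Longrightarrow> finite S"
    using F J finite_subset[of F "Pow J"] finite_subset[of _ J] by auto
  have N': "integrable_law ((N(i := \<mu> t)) j)" for t j using N \<mu> by simp
  have prob: "prob_space (N j)" "prob_space ((N(i := \<mu> t)) j)" for j t
    using N N'[of t j] unfolding integrable_law_def by auto
  interpret P: prob_space "PiM J' N" by (intro prob_space_PiM prob)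
  note int = integral_PiM_insert[OF prob(1) integrable_best[OF J(1) F N, unfolded J']]
  \<comment> \<open>The laws differ only in coordinate i, so the remaining product is common to all
    of them.\<close>
  have "PiM J' (N(i := \<mu> t)) = PiM J' N" for t
    by (intro PiM_cong) (auto simp: J'_def)
  then have int': "integrable (PiM J' N) (\<lambda>x. \<integral>w. best F h D (x(i := w)) \<partial>\<mu> t)"
    "(\<integral>w. best F h D w \<partial>PiM J (N(i := \<mu> t))) =
      (\<integral>x. (\<integral>w. best F h D (x(i := w)) \<partial>\<mu> t) \<partial>PiM J' N)" for t
    using integral_PiM_insert[where N = "N(i := \<mu> t)" and i = i and J = J'
        and f = "best F h D", OF prob(2)] integrable_best[where N = "N(i := \<mu> t)", OF J(1) F N']
    by (simp_all add: J')
  have slice: "(\<integral>w. best F h D (x(i := w)) \<partial>N i) \<le>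
    c + (\<Sum>t\<in>T. p t * (\<integral>w. best F h D (x(i := w)) \<partial>\<mu> t))" for x
  proof -
    \<comment> \<open>Sets S with i in \<open>S - D\<close> contribute slope 1 in w, all others a
      constant.\<close>
    have "best F h D (x(i := w)) = (MIN S\<in>F. ((\<Sum>j\<in>S - D - {i}. x j) + h S) +
      (if S \<in> {S. i \<in> S - D} then w else 0))" for w
    proof -
      have "(\<Sum>j\<in>S - D. (x(i := w)) j) = (\<Sum>j\<in>S - D - {i}. x j) + (if i \<in> S - D then w else 0)"
        if "S \<in> F" for S
      proof (cases "i \<in> S - D")
        case True
        have "(\<Sum>j\<in>S - D. (x(i := w)) j) = w + (\<Sum>j\<in>S - D - {i}. (x(i := w)) j)"
          using True fin(2)[OF that] by (subst sum.remove[of _ i]) auto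
        also have "(\<Sum>j\<in>S - D - {i}. (x(i := w)) j) = (\<Sum>j\<in>S - D - {i}. x j)"
          by (intro sum.cong) auto
        finally show ?thesis using True by simp
      next
        case False
        then have "S - D - {i} = S - D" by blast
        with False show ?thesis by (auto intro!: sum.cong)
      qed
      then show ?thesis unfolding best_def
        by (intro arg_cong[of _ _ Min] image_cong) auto
    qed
    then show ?thesis
      by (simp only:) (rule expectation_Min_affine_le[OF fin(1) F(2) N \<mu> p(2) c le])
  qed
  have "(\<integral>w. best F h D w \<partial>PiM J N) = (\<integral>x. (\<integral>w. best F h D (x(i := w)) \<partial>N i) \<partial>PiM J' N)"
    unfolding J' by (rule int(2))
  also have "\<dots> \<le> (\<integral>x. c + (\<Sum>t\<in>T. p t * (\<integral>w. best F h D (x(i := w)) \<partial>\<mu> t)) \<partial>PiM J' N)"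
    using int(1) int'(1) slice by (intro integral_mono) auto
  also have "\<dots> = c + (\<Sum>t\<in>T. p t * (\<integral>w. best F h D w \<partial>PiM J (N(i := \<mu> t))))"
    unfolding int'(2) using int'(1) p(1) by (simp add: P.prob_space)
  finally show ?thesis .
qed


section \<open>Position values\<close>

text \<open>Moved to the Borel sigma-algebra, where the laws of the surrogates live too, so that
  both can be factors of one product.\<close>

definition pmf_law :: "real pmf \<Rightarrow> real measure" where
  "pmf_law p = distr (measure_pmf p) borel (\<lambda>w. w)"

lemma integrable_law_pmf:
  assumes "finite (set_pmf p)"
  shows "integrable_law (pmf_law p)"
  unfolding integrable_law_def pmf_law_def
proof (intro conjI)
  show "prob_space (distr (measure_pmf p) borel (\<lambda>w. w))"
    by (rule measure_pmf.prob_space_distr) simp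
  show "integrable (distr (measure_pmf p) borel (\<lambda>w. w)) (\<lambda>w. w)"
    by (subst integrable_distr_eq) (simp_all add: integrable_measure_pmf_finite[OF assms])
qed simp

lemma integral_min_pmf_law: "(\<integral>w. min y w \<partial>pmf_law p) = min_mean p y"
  unfolding pmf_law_def min_mean_def by (subst integral_distr) simp_all

lemma best_le:
  assumes "finite F" "S \<in> F"
  shows "best F h D w \<le> (\<Sum>i\<in>S - D. w i) + h S"
  unfolding best_def using assms by (intro Min_le finite_imageI imageI)

text \<open>Passing to sets that contain i can only raise the minimum, and in each of these
  \<open>w i\<close> splits off as a summand.\<close>

lemma best_insert_le:
  assumes F: "finite F" "\<And>S. S \<in> F \<Longrightarrow> finite S"
    and "i \<notin> D" and ne: "{S\<in>F. insert i D \<subseteq> S} \<noteq> {}"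
  shows "best {S\<in>F. D \<subseteq> S} h D w \<le> w i + best {S\<in>F. insert i D \<subseteq> S} h (insert i D) w"
proof -
  have "best {S\<in>F. insert i D \<subseteq> S} h (insert i D) w
    \<in> (\<lambda>S. (\<Sum>i\<in>S - insert i D. w i) + h S) ` {S\<in>F. insert i D \<subseteq> S}"
    unfolding best_def using F(1) ne by (intro Min_in finite_imageI) auto
  then obtain S where S: "S \<in> F" "insert i D \<subseteq> S"
    and eq: "best {S\<in>F. insert i D \<subseteq> S} h (insert i D) w = (\<Sum>i\<in>S - insert i D. w i) + h S"
    by blast
  have "S - D = insert i (S - insert i D)" using S \<open>i \<notin> D\<close> by blast
  then have "sum w (S - D) = sum w (insert i (S - insert i D))" by (rule arg_cong)
  also have "\<dots> = w i + sum w (S - insert i D)"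
    using F(2)[OF S(1)] by (intro sum.insert) auto
  finally have "sum w (S - D) = w i + sum w (S - insert i D)" .
  moreover have "best {S\<in>F. D \<subseteq> S} h D w \<le> (\<Sum>i\<in>S - D. w i) + h S"
    using F(1) S by (intro best_le) auto
  ultimately show ?thesis using eq by simp
qed

text \<open>Indices outside the instance get a point mass at 0, so that every coordinate carries an
  integrable law.\<close>

definition position_law :: "('s, 'a) cics \<Rightarrow> real \<Rightarrow> (nat \<Rightarrow> 's) \<Rightarrow> nat \<Rightarrow> real measure" where
  "position_law I \<sigma> x i = pmf_law (if i \<in> {1..num I}
     then potential (mdps I i) (\<lambda>s. \<sigma> * val (mdps I i) s) (x i) else return_pmf 0)"

text \<open>Only feasible supersets of D can still be reached. The function h is a parameter because
  maximization uses the negated bonus.\<close>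

definition position_value ::
  "('s, 'a) cics \<Rightarrow> real \<Rightarrow> (nat set \<Rightarrow> real) \<Rightarrow> (nat \<Rightarrow> 's) \<Rightarrow> nat set \<Rightarrow> real" where
  "position_value I \<sigma> h x D =
     (\<integral>w. best {S\<in>feasible I. D \<subseteq> S} h D w \<partial>PiM {1..num I} (position_law I \<sigma> x))"

lemma integrable_law_position:
  assumes "cics_instance I"
  shows "integrable_law (position_law I \<sigma> x i)"
proof -
  have "finite (set_pmf (potential (mdps I i) (\<lambda>s. \<sigma> * val (mdps I i) s) (x i)))" if "i \<in> {1..num I}"
    using assms that unfolding cics_instance_def by (intro finite_potential) blast
  then have "finite (set_pmf (if i \<in> {1..num I}
     then potential (mdps I i) (\<lambda>s. \<sigma> * val (mdps I i) s) (x i) else return_pmf 0))" by simp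
  then show ?thesis unfolding position_law_def by (rule integrable_law_pmf)
qed

text \<open>Stopping and accepting give up freedom of completion, and the cost of an action covers
  the expected drop in value. Finite support is carried along to split expectations, and the
  nonempty family of completions to make \<open>best\<close> a genuine minimum.\<close>

lemma position_value_le_play:
  fixes I :: "('s, 'a) cics"
  assumes I: "cics_instance I"
    and "valid I x D \<pi>" "\<And>i. i \<in> {1..num I} \<Longrightarrow> x i \<in> states (mdps I i)"
  shows "finite (set_pmf (play I \<pi> x D)) \<and> {S\<in>feasible I. D \<subseteq> S} \<noteq> {} \<and>
    position_value I \<sigma> h x D \<le>
      measure_pmf.expectation (play I \<pi> x D) (\<lambda>(w, S, c). \<sigma> * w + h S + c)"
  using assms(2,3)
proof (induction x D \<pi> rule: valid.induct)
  let ?J = "{1..num I}"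
  have M: "costly_information_mdp (mdps I i)" if "i \<in> ?J" for i
    using I that unfolding cics_instance_def by blast
  have FJ: "feasible I \<subseteq> Pow ?J" using I unfolding cics_instance_def by blast
  then have F: "finite (feasible I)" "\<And>S. S \<in> feasible I \<Longrightarrow> finite S"
    using finite_subset[of "feasible I" "Pow ?J"] finite_subset[of _ ?J] by auto
  have law: "integrable_law (position_law I \<sigma> x i)" for x i
    by (rule integrable_law_position[OF I])
  then have prob: "prob_space (position_law I \<sigma> x i)" for x i
    unfolding integrable_law_def by blast
  have intb: "integrable (PiM ?J (position_law I \<sigma> x)) (best {S\<in>feasible I. D \<subseteq> S} h D)"
    if "{S\<in>feasible I. D \<subseteq> S} \<noteq> {}" for x D
    using FJ that law by (intro integrable_best) auto
  {
    case (stop D x)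
    interpret prob_space "PiM ?J (position_law I \<sigma> x)" by (intro prob_space_PiM prob)
    have ne: "{S\<in>feasible I. D \<subseteq> S} \<noteq> {}" using stop by blast
    have "best {S\<in>feasible I. D \<subseteq> S} h D w \<le> h D" for w
      using best_le[of "{S\<in>feasible I. D \<subseteq> S}" D h D w] F stop by simp
    then have "position_value I \<sigma> h x D \<le> h D"
      unfolding position_value_def by (intro integral_le_const intb ne) auto
    with ne show ?case by simp
  next
    case (accept i D x \<pi>)
    then have i: "i \<in> ?J" "i \<notin> D" by auto
    note IH = accept.IH[OF accept.prems]
    let ?M = "mdps I i"
    interpret prob_space "PiM ?J (position_law I \<sigma> x)" by (intro prob_space_PiM prob)
    have ne: "{S\<in>feasible I. D \<subseteq> S} \<noteq> {}" using IH by blast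
    \<comment> \<open>At a terminal state the law is a point mass, so the coordinate equals the
      accepted value almost surely and can be taken out of \<open>best\<close>.\<close>
    have law_i: "position_law I \<sigma> x i = pmf_law (return_pmf (\<sigma> * val ?M (x i)))"
      using i(1) accept.hyps potential_terminal[OF M[OF i(1)]] by (simp add: position_law_def)
    have "AE w in position_law I \<sigma> x i. w = \<sigma> * val ?M (x i)"
      unfolding law_i pmf_law_def by (subst AE_distr_iff) (auto simp: AE_measure_pmf_iff)
    then have "AE w in PiM ?J (position_law I \<sigma> x). w i = \<sigma> * val ?M (x i)"
      using i(1) by (intro AE_PiM_component prob) auto
    then have "AE w in PiM ?J (position_law I \<sigma> x). best {S\<in>feasible I. D \<subseteq> S} h D w \<le>
      \<sigma> * val ?M (x i) + best {S\<in>feasible I. insert i D \<subseteq> S} h (insert i D) w"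
    proof eventually_elim
      case (elim w)
      then show ?case
        using best_insert_le[of "feasible I" i D h w] F i IH by auto
    qed
    moreover have ne': "{S\<in>feasible I. insert i D \<subseteq> S} \<noteq> {}" using IH by blast
    have "integrable (PiM ?J (position_law I \<sigma> x)) (\<lambda>w. \<sigma> * val ?M (x i) +
        best {S\<in>feasible I. insert i D \<subseteq> S} h (insert i D) w)"
      by (rule Bochner_Integration.integrable_add[OF integrable_const intb[OF ne']])
    ultimately have "position_value I \<sigma> h x D \<le> (\<integral>w. \<sigma> * val ?M (x i) +
      best {S\<in>feasible I. insert i D \<subseteq> S} h (insert i D) w \<partial>PiM ?J (position_law I \<sigma> x))"
      unfolding position_value_def by (intro integral_mono_AE intb ne)
    also have "\<dots> = \<sigma> * val ?M (x i) + position_value I \<sigma> h x (insert i D)"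
      unfolding position_value_def
      by (subst Bochner_Integration.integral_add[OF integrable_const intb[OF ne']])
        (simp only: lebesgue_integral_const prob_space scaleR_one)
    also have "\<dots> \<le> \<sigma> * val ?M (x i) + measure_pmf.expectation (play I \<pi> x (insert i D))
        (\<lambda>(w, S, c). \<sigma> * w + h S + c)"
      using IH by simp
    also have "\<dots> = measure_pmf.expectation (play I (Accept i \<pi>) x D) (\<lambda>(w, S, c). \<sigma> * w + h S + c)"
      unfolding play.simps using IH
      by (intro expectation_map_pmf_add[symmetric]) (auto simp: algebra_simps)
    finally show ?case using ne IH by simp
  next
    case (advance i x a D k)
    let ?M = "mdps I i"
    let ?p = "trans ?M (x i) a"
    let ?E = "\<lambda>t. measure_pmf.expectation (play I (k t) (x(i := t)) D) (\<lambda>(w, S, c). \<sigma> * w + h S + c)"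
    note tr = mdp_finite_trans[OF M[OF advance.hyps(1)] advance.hyps(2,3)]
    have IH: "finite (set_pmf (play I (k t) (x(i := t)) D)) \<and> {S\<in>feasible I. D \<subseteq> S} \<noteq> {} \<and>
      position_value I \<sigma> h (x(i := t)) D \<le> ?E t" if "t \<in> set_pmf ?p" for t
      using that tr(2) advance.prems by (intro advance.IH) auto
    \<comment> \<open>The family of completions does not depend on the successor, so a single
      successor shows that it is nonempty.\<close>
    obtain t0 where "t0 \<in> set_pmf ?p" using set_pmf_not_empty by fast
    then have ne: "{S\<in>feasible I. D \<subseteq> S} \<noteq> {}" using IH by blast
    let ?\<mu> = "\<lambda>t. pmf_law (potential ?M (\<lambda>s. \<sigma> * val ?M s) t)"
    \<comment> \<open>Moving one MDP changes the law of its own coordinate alone, which is the form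
      that \<open>integral_best_exchange\<close> treats.\<close>
    have upd: "(position_law I \<sigma> x)(i := ?\<mu> t) = position_law I \<sigma> (x(i := t))" for t
      using advance.hyps(1) by (auto simp: position_law_def fun_eq_iff)
    have sum1: "(\<Sum>t\<in>set_pmf ?p. pmf ?p t) = 1" using tr(1) by (simp add: sum_pmf_eq_1)
    have "position_value I \<sigma> h x D \<le> cost ?M a + (\<Sum>t\<in>set_pmf ?p. pmf ?p t *
      (\<integral>w. best {S\<in>feasible I. D \<subseteq> S} h D w \<partial>PiM ?J ((position_law I \<sigma> x)(i := ?\<mu> t))))"
      unfolding position_value_def
    proof (rule integral_best_exchange)
      show "(\<integral>w. min y w \<partial>position_law I \<sigma> x i) \<le> cost ?M a +
        (\<Sum>t\<in>set_pmf ?p. pmf ?p t * (\<integral>w. min y w \<partial>?\<mu> t))" for y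
        using advance.hyps potential_step[OF M[OF advance.hyps(1)] advance.hyps(2,3)]
        by (simp add: position_law_def integral_min_pmf_law)
      show "integrable_law (?\<mu> t)" for t
        by (intro integrable_law_pmf finite_potential M advance.hyps)
    qed (use FJ ne law tr sum1 advance.hyps in auto)
    also have "\<dots> \<le> cost ?M a + (\<Sum>t\<in>set_pmf ?p. pmf ?p t * ?E t)"
      unfolding upd using IH
      by (intro add_left_mono sum_mono mult_left_mono) (auto simp: position_value_def)
    also have "\<dots> = (\<Sum>t\<in>set_pmf ?p. pmf ?p t * (cost ?M a + ?E t))"
      using sum1 by (simp add: distrib_left sum.distrib flip: sum_distrib_right)
    also have "\<dots> = (\<Sum>t\<in>set_pmf ?p. pmf ?p t * measure_pmf.expectation
      (map_pmf (\<lambda>(w, R, c). (w, R, cost ?M a + c)) (play I (k t) (x(i := t)) D))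
      (\<lambda>(w, S, c). \<sigma> * w + h S + c))"
      using IH by (intro sum.cong refl arg_cong2[of _ _ _ _ "(*)"] expectation_map_pmf_add[symmetric]) auto
    also have "\<dots> = measure_pmf.expectation (play I (Advance i a k) x D)
      (\<lambda>(w, S, c). \<sigma> * w + h S + c)"
      unfolding play.simps using IH tr(1) by (intro expectation_bind_pmf[symmetric]) auto
    finally show ?case using ne IH tr(1) by (auto intro!: finite_set_bind_pmf)
  next
    case (random p x D)
    let ?E = "\<lambda>\<pi>. measure_pmf.expectation (play I \<pi> x D) (\<lambda>(w, S, c). \<sigma> * w + h S + c)"
    have IH: "finite (set_pmf (play I \<pi> x D)) \<and> {S\<in>feasible I. D \<subseteq> S} \<noteq> {} \<and>
      position_value I \<sigma> h x D \<le> ?E \<pi>" if "\<pi> \<in> set_pmf p" for \<pi>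
      using that random.prems by (intro random.IH) auto
    obtain \<pi>0 where "\<pi>0 \<in> set_pmf p" using set_pmf_not_empty by fast
    then have ne: "{S\<in>feasible I. D \<subseteq> S} \<noteq> {}" using IH by blast
    have "position_value I \<sigma> h x D = (\<Sum>\<pi>\<in>set_pmf p. pmf p \<pi> * position_value I \<sigma> h x D)"
      using random.hyps(1) by (simp add: sum_pmf_eq_1 flip: sum_distrib_right)
    also have "\<dots> \<le> (\<Sum>\<pi>\<in>set_pmf p. pmf p \<pi> * ?E \<pi>)"
      using IH by (intro sum_mono mult_left_mono) auto
    also have "\<dots> = ?E (Random p)"
      unfolding play.simps bind_map_pmf using IH random.hyps(1)
      by (intro expectation_bind_pmf[symmetric]) auto
    finally show ?case
      using ne IH random.hyps(1) by (auto simp: bind_map_pmf intro!: finite_set_bind_pmf)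
  }
qed

text \<open>The MDPs in T are driven to terminals by arbitrary actions and accepted, one after the
  other. Hence the sets whose infimum and supremum define OPT are nonempty.\<close>

lemma exists_valid_policy:
  assumes I: "cics_instance I" and "T \<subseteq> {1..num I}" "T \<inter> D = {}" "D \<union> T \<in> feasible I"
    and x: "\<And>i. i \<in> {1..num I} \<Longrightarrow> x i \<in> states (mdps I i)"
  shows "\<exists>\<pi>. valid I x D \<pi>"
proof -
  have "finite T" using assms(2) finite_subset by blast
  then show ?thesis using assms(2-)
  proof (induction T arbitrary: x D rule: finite_induct)
    case empty
    then show ?case by (auto intro: valid.stop)
  next
    case (insert i T)
    have i: "i \<in> {1..num I}" "i \<notin> D" using insert.prems by auto
    have M: "costly_information_mdp (mdps I i)" using I i unfolding cics_instance_def by blast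
    have "\<exists>\<pi>. valid I (x(i := s)) D \<pi>" if "s \<in> states (mdps I i)" for s
      using that
    proof (induction s rule: wf_induct_rule[OF mdp_wf[OF M]])
      case (1 s)
      let ?x = "x(i := s)"
      show ?case
      proof (cases "s \<in> terminals (mdps I i)")
        case True
        have "\<exists>\<pi>. valid I ?x (insert i D) \<pi>"
          using insert.prems insert.hyps 1(2) by (intro insert.IH) auto
        then obtain \<pi> where "valid I ?x (insert i D) \<pi>" by blast
        then have "valid I ?x D (Accept i \<pi>)" using i True by (intro valid.accept) auto
        then show ?thesis by blast
      next
        case False
        then have s: "s \<in> states (mdps I i) - terminals (mdps I i)" using 1(2) by simp
        obtain a where a: "a \<in> actions (mdps I i) s"
          using M s unfolding costly_information_mdp_def by blast
        have "\<forall>t\<in>set_pmf (trans (mdps I i) s a). \<exists>\<pi>. valid I (x(i := t)) D \<pi>"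
          using s a mdp_finite_trans(2)[OF M s a] by (intro ballI 1(1)) (auto simp: succ_rel_def)
        then obtain k where "\<And>t. t \<in> set_pmf (trans (mdps I i) s a) \<Longrightarrow> valid I (x(i := t)) D (k t)"
          by metis
        then have "valid I ?x D (Advance i a k)"
          using i s a by (intro valid.advance) auto
        then show ?thesis by blast
      qed
    qed
    from this[of "x i"] show ?case using insert.prems i by simp
  qed
qed


section \<open>Comparison with the surrogates\<close>

text \<open>The defining property of a water filling surrogate speaks of its truncations; monotone
  convergence makes the variable itself integrable once the truncated means are bounded.\<close>

lemma integrable_of_min_bounded:
  fixes X :: "'w \<Rightarrow> real"
  assumes [measurable]: "X \<in> borel_measurable M"
    and int: "\<And>y. integrable M (\<lambda>\<omega>. min y (X \<omega>))"
    and bound: "\<And>y. (\<integral>\<omega>. min y (X \<omega>) \<partial>M) \<le> K"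
  shows "integrable M X"
proof -
  \<comment> \<open>Subtracting \<open>min 0 (X \<omega>)\<close> gives a nonnegative increasing
    sequence that is eventually constant at each point.\<close>
  let ?f = "\<lambda>n \<omega>. min (real n) (X \<omega>) - min 0 (X \<omega>)"
  have inc: "incseq (\<lambda>n. \<integral>\<omega>. ?f n \<omega> \<partial>M)"
    by (intro incseq_SucI integral_mono Bochner_Integration.integrable_diff int) auto
  have "(\<integral>\<omega>. ?f n \<omega> \<partial>M) \<le> K - (\<integral>\<omega>. min 0 (X \<omega>) \<partial>M)" for n
    using bound[of "real n"] int by simp
  from incseq_convergent[OF inc, rule_format, OF this]
  obtain L where L: "(\<lambda>n. \<integral>\<omega>. ?f n \<omega> \<partial>M) \<longlonglongrightarrow> L" by blast
  have "integrable M (\<lambda>\<omega>. X \<omega> - min 0 (X \<omega>))"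
  proof (rule integral_monotone_convergence_nonneg[where f = ?f, OF _ _ _ _ L])
    have "(\<lambda>n. ?f n \<omega>) \<longlonglongrightarrow> X \<omega> - min 0 (X \<omega>)" for \<omega>
    proof (rule tendsto_eventually)
      obtain k :: nat where "X \<omega> \<le> real k" using real_arch_simple by blast
      then show "\<forall>\<^sub>F n in sequentially. ?f n \<omega> = X \<omega> - min 0 (X \<omega>)"
        by (intro eventually_sequentiallyI[of k]) (auto simp: min_def)
    qed
    then show "AE \<omega> in M. (\<lambda>n. ?f n \<omega>) \<longlonglongrightarrow> X \<omega> - min 0 (X \<omega>)" by simp
    show "AE \<omega> in M. mono (\<lambda>n. ?f n \<omega>)" by (auto intro!: monoI simp: min_def)
    show "AE \<omega> in M. 0 \<le> ?f n \<omega>" for n by (auto simp: min_def)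
  qed (use int in auto)
  from Bochner_Integration.integrable_add[OF this int[of 0]] show ?thesis by simp
qed

lemma min_mean_le_expectation:
  assumes "finite (set_pmf p)"
  shows "min_mean p y \<le> measure_pmf.expectation p (\<lambda>w. w)"
  unfolding min_mean_def
  by (intro integral_mono integrable_measure_pmf_finite assms) auto

text \<open>The laws are replaced one coordinate at a time, along a growing set K of replaced
  coordinates.\<close>

lemma integral_best_mono:
  assumes J: "finite J" and F: "F \<subseteq> Pow J" "F \<noteq> {}"
    and N: "\<And>i. integrable_law (N i)" "\<And>i. integrable_law (N' i)"
    and le: "\<And>i y. i \<in> J \<Longrightarrow> (\<integral>w. min y w \<partial>N i) \<le> (\<integral>w. min y w \<partial>N' i)"
  shows "(\<integral>w. best F h D w \<partial>PiM J N) \<le> (\<integral>w. best F h D w \<partial>PiM J N')"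
proof -
  have "(\<integral>w. best F h D w \<partial>PiM J N) \<le>
    (\<integral>w. best F h D w \<partial>PiM J (\<lambda>i. if i \<in> K then N' i else N i))" if "K \<subseteq> J" for K
  proof -
    have "finite K" using that J finite_subset by blast
    then show ?thesis using that
    proof (induction K rule: finite_induct)
      case (insert k K)
      let ?N = "\<lambda>i. if i \<in> K then N' i else N i"
      \<comment> \<open>A degenerate exchange: one successor with weight 1 and cost 0.\<close>
      have "(\<integral>w. best F h D w \<partial>PiM J ?N) \<le> 0 + (\<Sum>t\<in>{()}. 1 *
        (\<integral>w. best F h D w \<partial>PiM J (?N(k := N' k))))"
        using insert.prems insert.hyps N J F le by (intro integral_best_exchange) auto
      moreover have "?N(k := N' k) = (\<lambda>i. if i \<in> insert k K then N' i else N i)"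
        by auto
      ultimately show ?case using insert.IH insert.prems by simp
    qed simp
  qed
  from this[of J] have "(\<integral>w. best F h D w \<partial>PiM J N) \<le>
    (\<integral>w. best F h D w \<partial>PiM J (\<lambda>i. if i \<in> J then N' i else N i))" by simp
  also have "PiM J (\<lambda>i. if i \<in> J then N' i else N i) = PiM J N'"
    by (intro PiM_cong) auto
  finally show ?thesis .
qed

text \<open>Independence makes the joint law a product. The criterion through product laws is for
  nonempty index sets; for empty J both sides equal \<open>h {}\<close>.\<close>

lemma (in prob_space) integral_best_indep_vars:
  assumes J: "finite J" and F: "F \<subseteq> Pow J" "F \<noteq> {}"
    and X: "indep_vars (\<lambda>_. borel) X J" "\<And>i. i \<in> J \<Longrightarrow> integrable M (X i)"
    and N: "\<And>i. integrable_law (N i)" "\<And>i. i \<in> J \<Longrightarrow> N i = distr M borel (X i)"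
  shows "(\<integral>\<omega>. best F h D (\<lambda>i. X i \<omega>) \<partial>M) = (\<integral>w. best F h D w \<partial>PiM J N)"
proof (cases "J = {}")
  case True
  interpret P: prob_space "PiM J N"
    using N(1) by (intro prob_space_PiM) (auto simp: integrable_law_def)
  have "F = {{}}" using F True by auto
  then have "best F h D = (\<lambda>_. h {})" by (simp add: best_def fun_eq_iff)
  then show ?thesis using prob_space P.prob_space by simp
next
  case False
  have rv: "random_variable borel (X i)" if "i \<in> J" for i
    using X(2)[OF that] by auto
  let ?X = "\<lambda>\<omega>. \<lambda>i\<in>J. X i \<omega>"
  \<comment> \<open>\<open>best\<close> reads only coordinates in J, so restricting to J, which
    gives a point of the product space, leaves it unchanged.\<close>
  have restr: "best F h D (\<lambda>i. X i \<omega>) = best F h D (?X \<omega>)" for \<omega>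
    unfolding best_def using F(1)
    by (intro arg_cong[of _ _ Min] image_cong refl arg_cong2[of _ _ _ _ "(+)"] sum.cong) auto
  have m: "?X \<in> measurable M (PiM J (\<lambda>_. borel))"
    by (intro measurable_restrict rv)
  have "distr M (PiM J (\<lambda>_. borel)) ?X = PiM J (\<lambda>i. distr M borel (X i))"
    using indep_vars_iff_distr_eq_PiM'[OF False, where M' = "\<lambda>_. borel" and X = X] rv X(1)
    by blast
  also have "\<dots> = PiM J N" using N(2) by (intro PiM_cong) auto
  finally have d: "distr M (PiM J (\<lambda>_. borel)) ?X = PiM J N" .
  have "best F h D \<in> borel_measurable (distr M (PiM J (\<lambda>_. borel)) ?X)"
    unfolding d using integrable_best[OF J F N(1)] by auto
  then have "best F h D \<in> borel_measurable (PiM J (\<lambda>_. borel))" by simp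
  from integral_distr[OF m this] have "(\<integral>w. best F h D w \<partial>PiM J N) = (\<integral>\<omega>. best F h D (?X \<omega>) \<partial>M)"
    unfolding d .
  then show ?thesis unfolding restr by simp
qed

text \<open>Both settings are instances, with \<sigma> = 1 or \<sigma> = -1. The chain runs from the
  surrogates to their product law, by comparison of truncated means to the product of the laws of
  the start states, and then to the cost of the policy.\<close>

lemma surrogate_bound:
  fixes I :: "('s, 'a) cics" and P :: "'w measure"
  assumes I: "cics_instance I" and P: "prob_space P"
    and indep: "prob_space.indep_vars P (\<lambda>_. borel) X {1..num I}"
    and int: "\<And>i y. i \<in> {1..num I} \<Longrightarrow> integrable P (\<lambda>\<omega>. min y (X i \<omega>))"
    and le: "\<And>i y. i \<in> {1..num I} \<Longrightarrow> (\<integral>\<omega>. min y (X i \<omega>) \<partial>P) \<le>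
      min_mean (potential (mdps I i) (\<lambda>s. \<sigma> * val (mdps I i) s) (start (mdps I i))) y"
    and valid: "valid I (start_pos I) {} \<pi>"
  shows "(\<integral>\<omega>. best (feasible I) h {} (\<lambda>i. X i \<omega>) \<partial>P) \<le>
    measure_pmf.expectation (play I \<pi> (start_pos I) {}) (\<lambda>(w, S, c). \<sigma> * w + h S + c)"
proof -
  interpret prob_space P by (rule P)
  let ?J = "{1..num I}"
  have F: "feasible I \<subseteq> Pow ?J" "feasible I \<noteq> {}" using I unfolding cics_instance_def by auto
  have M: "costly_information_mdp (mdps I i)" if "i \<in> ?J" for i
    using I that unfolding cics_instance_def by blast
  have rv: "random_variable borel (X i)" if "i \<in> ?J" for i
    using indep that unfolding indep_vars_def by auto
  \<comment> \<open>The mean of the law at the start state bounds all truncated means of the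
    surrogate.\<close>
  have intX: "integrable P (X i)" if "i \<in> ?J" for i
    by (rule integrable_of_min_bounded[OF rv[OF that] int[OF that]
          order_trans[OF le[OF that] min_mean_le_expectation[OF finite_potential[OF M[OF that]]]]])
  let ?N = "\<lambda>i. if i \<in> ?J then distr P borel (X i) else pmf_law (return_pmf 0)"
  have N: "integrable_law (?N i)" for i
  proof (cases "i \<in> ?J")
    case True
    have "integrable_law (distr P borel (X i))"
      unfolding integrable_law_def using rv[OF True] intX[OF True]
      by (simp add: prob_space_distr integrable_distr_eq)
    with True show ?thesis by simp
  next
    case False
    have "integrable_law (pmf_law (return_pmf 0))" by (rule integrable_law_pmf) simp
    with False show ?thesis by (simp only: if_False)
  qed
  have st: "start_pos I i \<in> states (mdps I i)" if "i \<in> ?J" for i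
    using M[OF that] unfolding start_pos_def costly_information_mdp_def by blast
  have "(\<integral>\<omega>. best (feasible I) h {} (\<lambda>i. X i \<omega>) \<partial>P) =
      (\<integral>w. best (feasible I) h {} w \<partial>PiM ?J ?N)"
    using N by (intro integral_best_indep_vars F indep intX) auto
  also have "\<dots> \<le> (\<integral>w. best (feasible I) h {} w \<partial>PiM ?J (position_law I \<sigma> (start_pos I)))"
  proof (rule integral_best_mono[OF _ F N integrable_law_position[OF I]])
    fix i y assume i: "i \<in> ?J"
    have "(\<integral>w. min y w \<partial>distr P borel (X i)) = (\<integral>\<omega>. min y (X i \<omega>) \<partial>P)"
      using rv[OF i] by (subst integral_distr) auto
    with le[OF i, of y] i show "(\<integral>w. min y w \<partial>?N i) \<le> (\<integral>w. min y w \<partial>position_law I \<sigma> (start_pos I) i)"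
      by (simp add: position_law_def integral_min_pmf_law start_pos_def)
  qed simp
  also have "\<dots> \<le> measure_pmf.expectation (play I \<pi> (start_pos I) {}) (\<lambda>(w, S, c). \<sigma> * w + h S + c)"
    using position_value_le_play[OF I valid st, of \<sigma> h] by (simp add: position_value_def)
  finally show ?thesis .
qed

theorem theorem14:
  fixes I :: "('s, 'a) cics" and P :: "'w measure"
  assumes "cics_instance I" and "prob_space P"
  shows "(\<forall>W :: nat \<Rightarrow> 'w \<Rightarrow> real.
            prob_space.indep_vars P (\<lambda>_. borel) W {1..num I} \<and>
            (\<forall>i \<in> {1..num I}. water_filling_surrogate P (W i) (mdps I i)) \<longrightarrow>
            OPT_min I \<ge> (\<integral>\<omega>. (MIN S \<in> feasible I. (\<Sum>i \<in> S. W i \<omega>) + bonus I S) \<partial>P))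
       \<and> (\<forall>W :: nat \<Rightarrow> 'w \<Rightarrow> real.
            prob_space.indep_vars P (\<lambda>_. borel) W {1..num I} \<and>
            (\<forall>i \<in> {1..num I}. water_draining_surrogate P (W i) (mdps I i)) \<longrightarrow>
            OPT_max I \<le> (\<integral>\<omega>. (MAX S \<in> feasible I. (\<Sum>i \<in> S. W i \<omega>) + bonus I S) \<partial>P))"
proof -
  interpret prob_space P by (rule assms(2))
  let ?J = "{1..num I}"
  have F: "feasible I \<subseteq> Pow ?J" "feasible I \<noteq> {}" and M: "\<And>i. i \<in> ?J \<Longrightarrow> costly_information_mdp (mdps I i)"
    using assms(1) unfolding cics_instance_def by auto
  have fin: "finite (feasible I)" using F(1) finite_subset by blast
  have st: "start_pos I i \<in> states (mdps I i)" if "i \<in> ?J" for i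
    using M[OF that] unfolding start_pos_def costly_information_mdp_def by blast
  \<comment> \<open>A valid policy exists, so OPT is an infimum or supremum of a nonempty set and a
    bound valid for every policy passes to it.\<close>
  obtain S0 where "S0 \<in> feasible I" using F(2) by blast
  then have ex: "\<exists>\<pi>. valid I (start_pos I) {} \<pi>"
    using F(1) st by (intro exists_valid_policy[OF assms(1), of S0]) auto
  show ?thesis
  proof (intro conjI allI impI)
    fix W :: "nat \<Rightarrow> 'w \<Rightarrow> real"
    assume W: "indep_vars (\<lambda>_. borel) W ?J \<and>
      (\<forall>i\<in>?J. water_filling_surrogate P (W i) (mdps I i))"
    then have b: "has_bochner_integral P (\<lambda>\<omega>. min y (W i \<omega>)) (local_min (mdps I i) y)"
      if "i \<in> ?J" for i y
      using that unfolding water_filling_surrogate_def by blast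
    have "(\<integral>\<omega>. best (feasible I) (bonus I) {} (\<lambda>i. W i \<omega>) \<partial>P) \<le>
      measure_pmf.expectation (play I \<pi> (start_pos I) {}) (\<lambda>(w, S, c). 1 * w + bonus I S + c)"
      if "valid I (start_pos I) {} \<pi>" for \<pi>
    proof (rule surrogate_bound[OF assms _ _ _ that])
      fix i y assume i: "i \<in> ?J"
      show "integrable P (\<lambda>\<omega>. min y (W i \<omega>))"
        using b[OF i] by (rule has_bochner_integral_iff[THEN iffD1, THEN conjunct1])
      show "(\<integral>\<omega>. min y (W i \<omega>) \<partial>P) \<le>
        min_mean (potential (mdps I i) (\<lambda>s. 1 * val (mdps I i) s) (start (mdps I i))) y"
        using local_min_le_potential[OF M[OF i], of y] b[OF i]
        by (simp add: has_bochner_integral_iff)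
    qed (use W in blast)
    then have "(\<integral>\<omega>. best (feasible I) (bonus I) {} (\<lambda>i. W i \<omega>) \<partial>P) \<le> OPT_min I"
      unfolding OPT_min_def using ex by (intro cInf_greatest) auto
    then show "(\<integral>\<omega>. (MIN S \<in> feasible I. (\<Sum>i \<in> S. W i \<omega>) + bonus I S) \<partial>P) \<le> OPT_min I"
      by (simp add: best_def)
  next
    fix W :: "nat \<Rightarrow> 'w \<Rightarrow> real"
    assume W: "indep_vars (\<lambda>_. borel) W ?J \<and>
      (\<forall>i\<in>?J. water_draining_surrogate P (W i) (mdps I i))"
    then have b: "has_bochner_integral P (\<lambda>\<omega>. max y (W i \<omega>)) (local_max (mdps I i) y)"
      if "i \<in> ?J" for i y
      using that unfolding water_draining_surrogate_def by blast
    \<comment> \<open>Since \<open>- max (- y) w = min y (- w)\<close>, the truncated means of the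
      negated surrogate are negated local maxima at the outside option \<open>- y\<close>.\<close>
    have neg: "has_bochner_integral P (\<lambda>\<omega>. min y (- W i \<omega>)) (- local_max (mdps I i) (- y))"
      if "i \<in> ?J" for i y
    proof -
      have "(\<lambda>\<omega>. min y (- W i \<omega>)) = (\<lambda>\<omega>. - max (- y) (W i \<omega>))"
        by (auto simp: min_def max_def)
      then show ?thesis using has_bochner_integral_minus[OF b[OF that, of "- y"]] by simp
    qed
    have indep: "indep_vars (\<lambda>_. borel) (\<lambda>i \<omega>. - W i \<omega>) ?J"
      using W by (intro indep_vars_compose2[where Y = "\<lambda>_ w. - w" and M' = "\<lambda>_. borel"]) auto
    have le: "(\<integral>\<omega>. best (feasible I) (\<lambda>S. - bonus I S) {} (\<lambda>i. - W i \<omega>) \<partial>P) \<le>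
      measure_pmf.expectation (play I \<pi> (start_pos I) {}) (\<lambda>(w, S, c). (-1) * w + - bonus I S + c)"
      if "valid I (start_pos I) {} \<pi>" for \<pi>
    proof (rule surrogate_bound[OF assms indep _ _ that])
      fix i y assume i: "i \<in> ?J"
      show "integrable P (\<lambda>\<omega>. min y (- W i \<omega>))"
        using neg[OF i] by (rule has_bochner_integral_iff[THEN iffD1, THEN conjunct1])
      show "(\<integral>\<omega>. min y (- W i \<omega>) \<partial>P) \<le>
        min_mean (potential (mdps I i) (\<lambda>s. (-1) * val (mdps I i) s) (start (mdps I i))) y"
        using local_max_ge_potential[OF M[OF i], of "- y"] neg[OF i]
        by (simp add: has_bochner_integral_iff)
    qed
    \<comment> \<open>Under the sign change the set of largest value becomes the set of smallest
      cost, with negated bonus.\<close>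
    have "(MAX S \<in> feasible I. (\<Sum>i \<in> S. W i \<omega>) + bonus I S) =
      - best (feasible I) (\<lambda>S. - bonus I S) {} (\<lambda>i. - W i \<omega>)" for \<omega>
    proof -
      have "- (MAX S \<in> feasible I. (\<Sum>i \<in> S. W i \<omega>) + bonus I S) =
        Min (uminus ` (\<lambda>S. (\<Sum>i \<in> S. W i \<omega>) + bonus I S) ` feasible I)"
        using fin F(2) by (intro minus_Max_eq_Min) auto
      also have "\<dots> = best (feasible I) (\<lambda>S. - bonus I S) {} (\<lambda>i. - W i \<omega>)"
        unfolding best_def image_image
        by (intro arg_cong[of _ _ Min] image_cong) (auto simp: sum_negf)
      finally show ?thesis by simp
    qed
    then have eq: "(\<integral>\<omega>. (MAX S \<in> feasible I. (\<Sum>i \<in> S. W i \<omega>) + bonus I S) \<partial>P) =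
      - (\<integral>\<omega>. best (feasible I) (\<lambda>S. - bonus I S) {} (\<lambda>i. - W i \<omega>) \<partial>P)"
      by simp
    have "measure_pmf.expectation q (\<lambda>(w, S, c). w + bonus I S - c) =
      - measure_pmf.expectation q (\<lambda>(w, S, c). (-1) * w + - bonus I S + c)" for q
      by (simp flip: Bochner_Integration.integral_minus add: case_prod_unfold algebra_simps)
    then show "OPT_max I \<le> (\<integral>\<omega>. (MAX S \<in> feasible I. (\<Sum>i \<in> S. W i \<omega>) + bonus I S) \<partial>P)"
      unfolding OPT_max_def eq using ex le by (intro cSup_least) auto
  qed
qed

end
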